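(* Let $A$ and $B$ be irreducible square matrices with entries in $\{0,1\}$, of sizes greater than $1$, both satisfying condition (I), and let $(X_A,\sigma_A)$, $(X_B,\sigma_B)$ be the corresponding one-sided topological Markov shifts. If $(X_A,\sigma_A)$ is continuously orbit equivalent to $(X_B,\sigma_B)$, then there exists a group isomorphism $\Phi:H^A\to H^B$ such that $\Phi(H^A_+)=H^B_+$. In particular, the two-sided topological Markov shifts $(\bar X_A,\bar\sigma_A)$ and $(\bar X_B,\bar\sigma_B)$ are flow equivalent.
   Context: Let $A$ be an $N\times N$ matrix ($N>1$) with entries in $\{0,1\}$ and no zero rows or columns. The one-sided topological Markov shift $(X_A,\sigma_A)$ is $X_A=\{(x_n)_{n\in\mathbb{N}}\in\{1,\dots,N\}^{\mathbb{N}}\mid A(x_n,x_{n+1})=1\ \forall n\in\mathbb{N}\}$ ($\mathbb{N}=\{1,2,\dots\}$) with the product topology and $\sigma_A((x_n)_n)=(x_{n+1})_n$. The two-sided topological Markov shift $(\bar X_A,\bar\sigma_A)$ is $\bar X_A=\{(x_n)_{n\in\mathbb{Z}}\in\{1,\dots,N\}^{\mathbb{Z}}\mid A(x_n,x_{n+1})=1\ \forall n\in\mathbb{Z}\}$ with $\bar\sigma_A((x_n)_{n\in\mathbb{Z}})=(x_{n+1})_{n\in\mathbb{Z}}$. The matrix $A$ satisfies condition (I) if and only if $X_A$ has no isolated points (equivalently, $X_A$ is a Cantor set). $A$ is irreducible if for all $i,j$ there is $n\geq1$ with $A^n(i,j)>0$. Write $\mathbb{Z}_+=\mathbb{N}\cup\{0\}$.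 Continuous orbit equivalence: for $x\in X_A$ put $\mathrm{orb}_{\sigma_A}(x)=\bigcup_{k=0}^\infty\bigcup_{l=0}^\infty\sigma_A^{-k}(\sigma_A^l(x))$. $(X_A,\sigma_A)$ and $(X_B,\sigma_B)$ are continuously orbit equivalent if there exist a homeomorphism $h:X_A\to X_B$ with $h(\mathrm{orb}_{\sigma_A}(x))=\mathrm{orb}_{\sigma_B}(h(x))$ for all $x\in X_A$, and continuous maps $k_1,l_1:X_A\to\mathbb{Z}_+$ and $k_2,l_2:X_B\to\mathbb{Z}_+$ such that $\sigma_B^{k_1(x)}(h(\sigma_A(x)))=\sigma_B^{l_1(x)}(h(x))$ for all $x\in X_A$ and $\sigma_A^{k_2(x)}(h^{-1}(\sigma_B(x)))=\sigma_A^{l_2(x)}(h^{-1}(x))$ for all $x\in X_B$. Ordered group: $C(X_A,\mathbb{Z})$ is the group of continuous functions $X_A\to\mathbb{Z}$ ($\mathbb{Z}$ discrete); $H^A=C(X_A,\mathbb{Z})/\{\xi-\xi\circ\sigma_A\mid\xi\in C(X_A,\mathbb{Z})\}$, $[\xi]$ denotes the class of $\xi$, and $H^A_+=\{[\xi]\in H^A\mid\xi(x)\geq0\ \forall x\in X_A\}$. Flow equivalence: the suspension space of $(\bar X_A,\bar\sigma_A)$ is the quotient of $\bar X_A\times\mathbb{R}$ by the relation generated by $(x,t+1)\sim(\bar\sigma_A(x),t)$, with the flow induced by translation in the second coordinate. Two two-sided topological Markov shifts are flow equivalent if there is an orientation-preserving homeomorphism between their suspension spaces, i.e. a homeomorphism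 carrying flow orbits to flow orbits and preserving the direction of the flow. *)

theory Defs
  imports
    "HOL-Analysis.Function_Topology"
    "HOL-Analysis.Isolated"
    "HOL-Algebra.Coset"
    "Jordan_Normal_Form.Matrix"
begin

text \<open>
  Matrices are indexed from 0, so the alphabet of an \<open>N \<times> N\<close> matrix is \<open>{0..<N}\<close> instead of
  \<open>{1..N}\<close>, and one-sided sequences are indexed from 0. Sequences are elements of the function
  types \<open>nat \<Rightarrow> nat\<close> and \<open>int \<Rightarrow> nat\<close>, whose type-class topology is the product topology over the
  discrete space \<open>nat\<close>; shift spaces carry the subspace topology.
\<close>

section \<open>Topological Markov shifts\<close>

definition markov_matrix :: "nat \<Rightarrow> nat mat \<Rightarrow> bool" where
  "markov_matrix N A \<longleftrightarrow>
     A \<in> carrier_mat N N \<and> 1 < N \<and>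
     (\<forall>i<N. \<forall>j<N. A $$ (i, j) \<in> {0, 1}) \<and>
     (\<forall>i<N. \<exists>j<N. A $$ (i, j) \<noteq> 0) \<and>
     (\<forall>j<N. \<exists>i<N. A $$ (i, j) \<noteq> 0)"

definition irreducible_matrix :: "nat mat \<Rightarrow> bool" where
  "irreducible_matrix A \<longleftrightarrow>
     (\<forall>i<dim_row A. \<forall>j<dim_row A. \<exists>n\<ge>1. (A ^\<^sub>m n) $$ (i, j) > 0)"

definition one_sided_shift :: "nat mat \<Rightarrow> (nat \<Rightarrow> nat) set" where
  "one_sided_shift A = {x. (\<forall>n. x n < dim_row A) \<and> (\<forall>n. A $$ (x n, x (n + 1)) = 1)}"

definition shift_map :: "(nat \<Rightarrow> nat) \<Rightarrow> (nat \<Rightarrow> nat)" where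
  "shift_map x = (\<lambda>n. x (n + 1))"

definition two_sided_shift :: "nat mat \<Rightarrow> (int \<Rightarrow> nat) set" where
  "two_sided_shift A = {x. (\<forall>n. x n < dim_row A) \<and> (\<forall>n. A $$ (x n, x (n + 1)) = 1)}"

definition two_sided_shift_map :: "(int \<Rightarrow> nat) \<Rightarrow> (int \<Rightarrow> nat)" where
  "two_sided_shift_map x = (\<lambda>n. x (n + 1))"

definition condition_I :: "nat mat \<Rightarrow> bool" where
  "condition_I A \<longleftrightarrow> (\<forall>x\<in>one_sided_shift A. \<not> x isolated_in one_sided_shift A)"

lemma shift_map_in: "x \<in> one_sided_shift A \<Longrightarrow> shift_map x \<in> one_sided_shift A"
  by (simp add: one_sided_shift_def shift_map_def)

lemma continuous_shift_map: "continuous_on UNIV shift_map"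
  unfolding shift_map_def by (intro continuous_on_coordinatewise_then_product) simp


section \<open>Continuous orbit equivalence\<close>

definition shift_orbit :: "nat mat \<Rightarrow> (nat \<Rightarrow> nat) \<Rightarrow> (nat \<Rightarrow> nat) set" where
  "shift_orbit A x =
     (\<Union>k. \<Union>l. {y \<in> one_sided_shift A. (shift_map ^^ k) y = (shift_map ^^ l) x})"

text \<open>The map \<open>g\<close> is the inverse of \<open>h\<close>.\<close>

definition continuously_orbit_equivalent :: "nat mat \<Rightarrow> nat mat \<Rightarrow> bool" where
  "continuously_orbit_equivalent A B \<longleftrightarrow>
     (\<exists>h g. homeomorphism (one_sided_shift A) (one_sided_shift B) h g \<and>
       (\<forall>x\<in>one_sided_shift A. h ` shift_orbit A x = shift_orbit B (h x)) \<and>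
       (\<exists>k1 l1 :: (nat \<Rightarrow> nat) \<Rightarrow> nat.
          continuous_on (one_sided_shift A) k1 \<and> continuous_on (one_sided_shift A) l1 \<and>
          (\<forall>x\<in>one_sided_shift A.
             (shift_map ^^ k1 x) (h (shift_map x)) = (shift_map ^^ l1 x) (h x))) \<and>
       (\<exists>k2 l2 :: (nat \<Rightarrow> nat) \<Rightarrow> nat.
          continuous_on (one_sided_shift B) k2 \<and> continuous_on (one_sided_shift B) l2 \<and>
          (\<forall>x\<in>one_sided_shift B.
             (shift_map ^^ k2 x) (g (shift_map x)) = (shift_map ^^ l2 x) (g x))))"


section \<open>The ordered group\<close>

text \<open>
  Functions on the shift space are represented by functions on the whole type that take the
  value \<open>undefined\<close> outside it, so that equality of representatives is equality on the shift
  space. The group is additive; its addition is the \<open>mult\<close> field of the record.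
\<close>

definition cont_int_group :: "nat mat \<Rightarrow> ((nat \<Rightarrow> nat) \<Rightarrow> int) monoid" where
  "cont_int_group A =
     \<lparr>carrier = {\<xi> \<in> extensional (one_sided_shift A). continuous_on (one_sided_shift A) \<xi>},
      monoid.mult = (\<lambda>\<xi> \<eta>. restrict (\<lambda>x. \<xi> x + \<eta> x) (one_sided_shift A)),
      one = restrict (\<lambda>x. 0) (one_sided_shift A)\<rparr>"

definition coboundaries :: "nat mat \<Rightarrow> ((nat \<Rightarrow> nat) \<Rightarrow> int) set" where
  "coboundaries A =
     {restrict (\<lambda>x. \<xi> x - \<xi> (shift_map x)) (one_sided_shift A) | \<xi>.
        \<xi> \<in> carrier (cont_int_group A)}"

definition H_group :: "nat mat \<Rightarrow> ((nat \<Rightarrow> nat) \<Rightarrow> int) set monoid" where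
  "H_group A = cont_int_group A Mod coboundaries A"

definition H_class :: "nat mat \<Rightarrow> ((nat \<Rightarrow> nat) \<Rightarrow> int) \<Rightarrow> ((nat \<Rightarrow> nat) \<Rightarrow> int) set" where
  "H_class A \<xi> = r_coset (cont_int_group A) (coboundaries A) \<xi>"

definition H_positive :: "nat mat \<Rightarrow> ((nat \<Rightarrow> nat) \<Rightarrow> int) set set" where
  "H_positive A =
     {H_class A \<xi> | \<xi>. \<xi> \<in> carrier (cont_int_group A) \<and> (\<forall>x\<in>one_sided_shift A. \<xi> x \<ge> 0)}"

lemma continuous_on_int_uminus:
  fixes f :: "'a::topological_space \<Rightarrow> int"
  assumes "continuous_on S f"
  shows "continuous_on S (\<lambda>x. - f x)"
  by (rule continuous_on_compose2[OF _ assms, of UNIV])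
     (auto simp: continuous_on_open_vimage open_discrete)

lemma comm_group_cont_int_group: "comm_group (cont_int_group A)"
proof (rule comm_groupI)
  fix \<xi> assume \<xi>: "\<xi> \<in> carrier (cont_int_group A)"
  show "\<exists>\<eta>\<in>carrier (cont_int_group A).
          \<eta> \<otimes>\<^bsub>cont_int_group A\<^esub> \<xi> = \<one>\<^bsub>cont_int_group A\<^esub>"
  proof (rule bexI)
    show "restrict (\<lambda>x. - \<xi> x) (one_sided_shift A) \<in> carrier (cont_int_group A)"
      using \<xi> by (auto simp: cont_int_group_def intro!: continuous_on_int_uminus)
  qed (auto simp: cont_int_group_def)
qed (auto simp: cont_int_group_def fun_eq_iff extensional_def
      intro!: continuous_on_add continuous_on_const)

lemma normal_coboundaries: "normal (coboundaries A) (cont_int_group A)"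
proof -
  let ?G = "cont_int_group A" and ?X = "one_sided_shift A"
  define d where "d = (\<lambda>\<xi> :: (nat \<Rightarrow> nat) \<Rightarrow> int. restrict (\<lambda>x. \<xi> x - \<xi> (shift_map x)) ?X)"
  have group: "group ?G"
    using comm_group_cont_int_group by (rule comm_group.axioms)
  have d_in: "d \<xi> \<in> carrier ?G" if "\<xi> \<in> carrier ?G" for \<xi>
  proof -
    have \<xi>: "continuous_on ?X \<xi>"
      using that by (simp add: cont_int_group_def)
    have "continuous_on ?X (\<lambda>x. \<xi> (shift_map x))"
      by (rule continuous_on_compose2[OF \<xi> continuous_on_subset[OF continuous_shift_map]])
         (auto intro: shift_map_in)
    from continuous_on_add[OF \<xi> continuous_on_int_uminus[OF this]] show ?thesis
      by (simp add: cont_int_group_def d_def)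
  qed
  have "d \<in> hom ?G ?G"
  proof (rule homI)
    fix \<xi> \<eta> assume "\<xi> \<in> carrier ?G" "\<eta> \<in> carrier ?G"
    show "d (\<xi> \<otimes>\<^bsub>?G\<^esub> \<eta>) = d \<xi> \<otimes>\<^bsub>?G\<^esub> d \<eta>"
      by (rule ext) (simp add: cont_int_group_def d_def shift_map_in restrict_def)
  qed (rule d_in)
  then have "group_hom ?G ?G d"
    by (intro group_hom.intro group_hom_axioms.intro group)
  then have "subgroup (d ` carrier ?G) ?G"
    by (rule group_hom.img_is_subgroup)
  moreover have "d ` carrier ?G = coboundaries A"
    unfolding coboundaries_def d_def by blast
  ultimately show ?thesis
    using comm_group.subgroup_imp_normal[OF comm_group_cont_int_group] by simp
qed


section \<open>Suspension and flow equivalence\<close>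

definition suspension_step :: "nat mat \<Rightarrow> ((int \<Rightarrow> nat) \<times> real) \<Rightarrow> ((int \<Rightarrow> nat) \<times> real) \<Rightarrow> bool" where
  "suspension_step A p q \<longleftrightarrow>
     (\<exists>x\<in>two_sided_shift A. \<exists>t. p = (x, t + 1) \<and> q = (two_sided_shift_map x, t))"

definition suspension_rel ::
    "nat mat \<Rightarrow> (((int \<Rightarrow> nat) \<times> real) \<times> ((int \<Rightarrow> nat) \<times> real)) set" where
  "suspension_rel A =
     {(p, q). p \<in> two_sided_shift A \<times> UNIV \<and> q \<in> two_sided_shift A \<times> UNIV \<and>
              equivclp (suspension_step A) p q}"

definition suspension_space :: "nat mat \<Rightarrow> ((int \<Rightarrow> nat) \<times> real) set topology" where
  "suspension_space A =
     topology (\<lambda>U. U \<subseteq> (two_sided_shift A \<times> UNIV) // suspension_rel A \<and>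
                   openin (top_of_set (two_sided_shift A \<times> UNIV)) (\<Union>U))"

text \<open>A point of the suspension is an equivalence class; the flow translates all its members.\<close>

definition suspension_flow ::
    "real \<Rightarrow> ((int \<Rightarrow> nat) \<times> real) set \<Rightarrow> ((int \<Rightarrow> nat) \<times> real) set" where
  "suspension_flow s c = (\<lambda>(x, t). (x, t + s)) ` c"

definition flow_orbit :: "((int \<Rightarrow> nat) \<times> real) set \<Rightarrow> ((int \<Rightarrow> nat) \<times> real) set set" where
  "flow_orbit c = range (\<lambda>s. suspension_flow s c)"

text \<open>
  The direction of the flow is preserved when, along every orbit, the homeomorphism is an
  increasing continuous reparametrisation of time.
\<close>

definition flow_equivalent :: "nat mat \<Rightarrow> nat mat \<Rightarrow> bool" where
  "flow_equivalent A B \<longleftrightarrow>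
     (\<exists>h. homeomorphic_map (suspension_space A) (suspension_space B) h \<and>
       (\<forall>c\<in>topspace (suspension_space A). h ` flow_orbit c = flow_orbit (h c)) \<and>
       (\<forall>c\<in>topspace (suspension_space A). \<exists>\<tau> :: real \<Rightarrow> real.
          \<tau> 0 = 0 \<and> continuous_on UNIV \<tau> \<and> strict_mono \<tau> \<and>
          (\<forall>s. h (suspension_flow s c) = suspension_flow (\<tau> s) (h c))))"

lemma equiv_suspension_rel: "equiv (two_sided_shift A \<times> UNIV) (suspension_rel A)"
  unfolding suspension_rel_def
  by (rule equivI)
     (auto simp: refl_on_def sym_def trans_def intro: equivclp_sym equivclp_trans)

lemma openin_suspension_space:
  "openin (suspension_space A) U \<longleftrightarrow>
     U \<subseteq> (two_sided_shift A \<times> UNIV) // suspension_rel A \<and>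
     openin (top_of_set (two_sided_shift A \<times> UNIV)) (\<Union>U)"
proof -
  let ?X = "two_sided_shift A \<times> (UNIV :: real set)"
  let ?Q = "?X // suspension_rel A"
  have "istopology (\<lambda>U. U \<subseteq> ?Q \<and> openin (top_of_set ?X) (\<Union>U))"
    unfolding istopology_def
  proof (intro conjI allI impI)
    fix S T assume S: "S \<subseteq> ?Q \<and> openin (top_of_set ?X) (\<Union>S)"
      and T: "T \<subseteq> ?Q \<and> openin (top_of_set ?X) (\<Union>T)"
    have "\<Union>(S \<inter> T) = \<Union>S \<inter> \<Union>T"
    proof
      show "\<Union>S \<inter> \<Union>T \<subseteq> \<Union>(S \<inter> T)"
      proof
        fix p assume "p \<in> \<Union>S \<inter> \<Union>T"
        then obtain c d where cd: "c \<in> S" "d \<in> T" "p \<in> c" "p \<in> d" by auto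
        then have "c = d"
          using quotient_disj[OF equiv_suspension_rel, of c A d] S T by blast
        then show "p \<in> \<Union>(S \<inter> T)" using cd by auto
      qed
    qed auto
    then show "openin (top_of_set ?X) (\<Union>(S \<inter> T))"
      using S T by (simp add: openin_Int)
  next
    fix \<K> assume K: "\<forall>K\<in>\<K>. K \<subseteq> ?Q \<and> openin (top_of_set ?X) (\<Union>K)"
    have "\<Union>(\<Union>\<K>) = (\<Union>K\<in>\<K>. \<Union>K)" by auto
    then show "openin (top_of_set ?X) (\<Union>(\<Union>\<K>))"
      using K openin_Union[of "Union ` \<K>" "top_of_set ?X"] by auto
  qed auto
  then show ?thesis
    by (simp add: suspension_space_def topology_inverse')
qed

lemma topspace_suspension_space:
  "topspace (suspension_space A) = (two_sided_shift A \<times> UNIV) // suspension_rel A"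
proof -
  let ?X = "two_sided_shift A \<times> (UNIV :: real set)"
  have "openin (suspension_space A) (?X // suspension_rel A)"
    by (simp add: openin_suspension_space Union_quotient[OF equiv_suspension_rel])
  then show ?thesis
    by (intro subset_antisym openin_subset
        conjunct1[OF iffD1[OF openin_suspension_space openin_topspace]])
qed

lemma quotient_map_suspension:
  "quotient_map (top_of_set (two_sided_shift A \<times> UNIV)) (suspension_space A)
     (\<lambda>p. suspension_rel A `` {p})"
proof -
  let ?X = "two_sided_shift A \<times> (UNIV :: real set)"
  have preimage: "{p \<in> ?X. suspension_rel A `` {p} \<in> U} = \<Union>U"
    if U: "U \<subseteq> ?X // suspension_rel A" for U
  proof
    show "{p \<in> ?X. suspension_rel A `` {p} \<in> U} \<subseteq> \<Union>U"
      using equiv_class_self[OF equiv_suspension_rel] by blast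
    show "\<Union>U \<subseteq> {p \<in> ?X. suspension_rel A `` {p} \<in> U}"
    proof
      fix p assume "p \<in> \<Union>U"
      then obtain c where c: "c \<in> U" "p \<in> c" by auto
      then obtain q where q: "q \<in> ?X" "c = suspension_rel A `` {q}"
        using U unfolding quotient_def by blast
      then have "(q, p) \<in> suspension_rel A"
        using c by simp
      then have "c = suspension_rel A `` {p}"
        using q equiv_class_eq[OF equiv_suspension_rel] by simp
      moreover have "p \<in> ?X"
        using q c by (auto simp: suspension_rel_def)
      ultimately show "p \<in> {p \<in> ?X. suspension_rel A `` {p} \<in> U}" using c by auto
    qed
  qed
  show ?thesis
    unfolding quotient_map_def topspace_suspension_space openin_suspension_space
      topspace_euclidean_subtopology
  proof (intro conjI allI impI)
    show "(\<lambda>p. suspension_rel A `` {p}) ` ?X = ?X // suspension_rel A"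
      by (simp only: quotient_def UNION_singleton_eq_range)
  next
    fix U assume U: "U \<subseteq> ?X // suspension_rel A"
    then show "openin (top_of_set ?X) {p \<in> ?X. suspension_rel A `` {p} \<in> U} =
        (U \<subseteq> ?X // suspension_rel A \<and> openin (top_of_set ?X) (\<Union>U))"
      by (simp only: preimage[OF U] simp_thms)
  qed
qed

lemma suspension_step_translate:
  "suspension_step A (x, t) (y, u) \<Longrightarrow> suspension_step A (x, t + s) (y, u + s)"
  unfolding suspension_step_def by (auto simp: algebra_simps)

lemma suspension_rel_translate:
  assumes "((x, t), (y, u)) \<in> suspension_rel A"
  shows "((x, t + s), (y, u + s)) \<in> suspension_rel A"
proof -
  have "equivclp (suspension_step A) (fst p, snd p + s) (fst q, snd q + s)"
    if "equivclp (suspension_step A) p q" for p q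
    using that
  proof (induction rule: equivclp_induct)
    case (step q r)
    then have "suspension_step A (fst q, snd q + s) (fst r, snd r + s) \<or>
               suspension_step A (fst r, snd r + s) (fst q, snd q + s)"
      by (metis prod.collapse suspension_step_translate)
    then show ?case
      using step.IH by (meson equivclp_into_equivclp)
  qed auto
  from this[of "(x, t)" "(y, u)"] assms show ?thesis
    by (auto simp: suspension_rel_def)
qed

lemma suspension_flow_class:
  "suspension_flow s (suspension_rel A `` {(x, t)}) = suspension_rel A `` {(x, t + s)}"
proof
  show "suspension_flow s (suspension_rel A `` {(x, t)}) \<subseteq> suspension_rel A `` {(x, t + s)}"
    by (auto simp: suspension_flow_def suspension_rel_translate)
  show "suspension_rel A `` {(x, t + s)} \<subseteq> suspension_flow s (suspension_rel A `` {(x, t)})"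
  proof
    fix p assume p: "p \<in> suspension_rel A `` {(x, t + s)}"
    obtain y u where [simp]: "p = (y, u)" by fastforce
    have "((x, t), (y, u - s)) \<in> suspension_rel A"
      using p suspension_rel_translate[of x "t + s" y u A "- s"] by simp
    then have "(\<lambda>(x, t). (x, t + s)) (y, u - s) \<in> suspension_flow s (suspension_rel A `` {(x, t)})"
      unfolding suspension_flow_def by (intro imageI) simp
    then show "p \<in> suspension_flow s (suspension_rel A `` {(x, t)})"
      by simp
  qed
qed

end

theory Submission
  imports Defs "HOL-Analysis.Urysohn"
begin

text \<open>
  A continuous orbit equivalence \<open>h\<close> with exponents \<open>k, l\<close> sends an integer function \<open>f\<close> on \<open>X\<^sub>B\<close> to
  the function on \<open>X\<^sub>A\<close> that sums \<open>f\<close> along the orbit from \<open>h x\<close> to \<open>h (\<sigma> x)\<close>. The corresponding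
  map for \<open>h\<^sup>-\<^sup>1\<close> is its exact inverse, because the points that are not eventually periodic are
  dense and on them the lag between tail equivalent points is unique. At a periodic point the lag
  \<open>l - k\<close> has positive sum, since inverse branches contract and \<open>h\<close> preserves contraction; so
  nonnegative functions are sent to functions with nonnegative sums over cycles, and these are
  cohomologous to nonnegative functions.

  The same positivity makes the sums of the lag grow linearly, hence \<open>h\<close> extends along the past to a
  map \<open>\<theta>\<close> of the two-sided shifts with \<open>\<theta> (\<sigma>\<^sup>n x) = \<sigma>\<^sup>c \<theta> x\<close>, \<open>c\<close> being the lag cocycle. Together with
  a strictly increasing real reparametrisation of the cocycle it induces a homeomorphism of the
  suspensions, which is bijective because \<open>\<theta>\<close> is inverted up to the flow by the map induced by \<open>h\<^sup>-\<^sup>1\<close>.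
\<close>

section \<open>Continuous functions on shift spaces\<close>

text \<open>The exponents \<open>k\<close> and \<open>l\<close> are only continuous choices: at
  eventually periodic points the lag between two points of an orbit is ambiguous, so identities
  between cocycles cannot be checked point by point. What is unambiguous is the value of a cocycle
  once the lag is fixed. Computations are therefore phrased with two tail equivalent points and a
  lag, that is, with arrows of the orbit groupoid. Continuous integer functions depend on finitely
  many letters by compactness; this turns density into equality, and cycle conditions into uniform
  bounds by a pigeonhole argument on words. A second obstacle is that \<open>h\<close> need not
  intertwine the shifts and agrees with the two-sided map only from some coordinate on. The
  resulting discrepancy \<open>defect\<close> is why the two-sided maps are mutually inverse only up
  to a shift that depends on the point. Flow equivalence is constructed directly from
  \<open>h\<close>, without passing through the ordered groups.\<close>

lemma funpow_shift_map: "(shift_map ^^ n) x = (\<lambda>i. x (i + n))"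
  by (induction n) (auto simp: shift_map_def fun_eq_iff)

lemma funpow_shift_map_in:
  "x \<in> one_sided_shift A \<Longrightarrow> (shift_map ^^ n) x \<in> one_sided_shift A"
  by (induction n) (auto intro: shift_map_in)

lemma open_cylinder:
  fixes x :: "'i \<Rightarrow> nat"
  assumes "finite F"
  shows "open {y. \<forall>i\<in>F. y i = x i}"
proof -
  have "{y. \<forall>i\<in>F. y i = x i} = (\<Inter>i\<in>F. (\<lambda>y. y i) -` {x i})" by auto
  also have "open \<dots>"
    using assms
    by (intro open_INT ballI open_vimage open_discrete)
       (auto intro: continuous_on_product_coordinates)
  finally show ?thesis .
qed

lemma continuous_on_finite_window:
  fixes f :: "('i \<Rightarrow> nat) \<Rightarrow> 'b::topological_space"
  assumes "\<And>x. x \<in> S \<Longrightarrow> \<exists>F. finite F \<and> (\<forall>y\<in>S. (\<forall>i\<in>F. y i = x i) \<longrightarrow> f y = f x)"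
  shows "continuous_on S f"
  unfolding continuous_on_def
proof
  fix x assume "x \<in> S"
  then obtain F where F: "finite F" "\<forall>y\<in>S. (\<forall>i\<in>F. y i = x i) \<longrightarrow> f y = f x"
    using assms by blast
  have "eventually (\<lambda>y. f x = f y) (at x within S)"
    unfolding eventually_at_topological
    by (rule exI[of _ "{y. \<forall>i\<in>F. y i = x i}"]) (use F open_cylinder[OF F(1)] in auto)
  then show "(f \<longlongrightarrow> f x) (at x within S)"
    by (rule Lim_transform_eventually[OF tendsto_const])
qed

text \<open>Two functions are separated by preimages under a coordinate at which they differ. The
  instance makes compact sets of sequences closed.\<close>

instance "fun" :: (type, t2_space) t2_space
proof
  fix f g :: "'a \<Rightarrow> 'b" assume "f \<noteq> g"
  then obtain i where i: "f i \<noteq> g i" by auto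
  obtain U V where UV: "open U" "open V" "f i \<in> U" "g i \<in> V" "U \<inter> V = {}"
    using hausdorff[OF i] by metis
  have "open ((\<lambda>f. f i) -` U)" "open ((\<lambda>f. f i) -` V)"
    using UV(1,2) by (simp_all add: open_vimage)
  moreover have "f \<in> (\<lambda>f. f i) -` U" "g \<in> (\<lambda>f. f i) -` V" using UV(3,4) by simp_all
  moreover have "(\<lambda>f. f i) -` U \<inter> (\<lambda>f. f i) -` V = {}"
    unfolding vimage_Int[symmetric] UV(5) by simp
  ultimately show "\<exists>U V. open U \<and> open V \<and> f \<in> U \<and> g \<in> V \<and> U \<inter> V = {}"
    by blast
qed

lemma Hausdorff_space_t2: "Hausdorff_space (euclidean :: 'a::t2_space topology)"
  unfolding Hausdorff_space_def disjnt_def open_openin[symmetric] using hausdorff by metis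

section \<open>Cylinders and uniform local constancy\<close>

lemma open_contains_cylinder:
  fixes x :: "'i \<Rightarrow> 'b::topological_space"
  assumes "open U" "x \<in> U"
  shows "\<exists>F. finite F \<and> {y. \<forall>i\<in>F. y i = x i} \<subseteq> U"
proof -
  have "openin (product_topology (\<lambda>i::'i. euclidean) UNIV) U"
    using assms(1) by (simp add: euclidean_product_topology)
  from product_topology_open_contains_basis[OF this assms(2)]
  obtain X where X: "x \<in> (\<Pi>\<^sub>E i\<in>UNIV. X i)" "finite {i. X i \<noteq> UNIV}" "(\<Pi>\<^sub>E i\<in>UNIV. X i) \<subseteq> U"
    by auto
  have "{y. \<forall>i\<in>{i. X i \<noteq> UNIV}. y i = x i} \<subseteq> (\<Pi>\<^sub>E i\<in>UNIV. X i)"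
  proof
    fix y assume y: "y \<in> {y. \<forall>i\<in>{i. X i \<noteq> UNIV}. y i = x i}"
    have "y i \<in> X i" for i
      using y X(1) by (cases "X i = UNIV") (auto simp: PiE_iff)
    then show "y \<in> (\<Pi>\<^sub>E i\<in>UNIV. X i)" by (simp add: PiE_iff)
  qed
  from X(2) order_trans[OF this X(3)] show ?thesis by (intro exI conjI)
qed

text \<open>Uniform continuity in combinatorial form: finitely many cylinders on which
  \<open>f\<close> is constant cover \<open>S\<close>, and the longest of their lengths serves
  everywhere.\<close>

lemma compact_uniform_window:
  fixes f :: "(nat \<Rightarrow> nat) \<Rightarrow> 'b::discrete_topology"
  assumes "compact S" "continuous_on S f"
  shows "\<exists>n. \<forall>x\<in>S. \<forall>y\<in>S. (\<forall>i<n. x i = y i) \<longrightarrow> f x = f y"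
proof -
  have "\<exists>n. \<forall>y\<in>S. (\<forall>i<n. y i = x i) \<longrightarrow> f y = f x" if x: "x \<in> S" for x
  proof -
    obtain T where T: "open T" "f -` {f x} \<inter> S = T \<inter> S"
      using assms(2) open_discrete unfolding continuous_on_open_invariant by metis
    have "x \<in> T" using T x by blast
    from open_contains_cylinder[OF T(1) this]
    obtain F where F: "finite F" "{y. \<forall>i\<in>F. y i = x i} \<subseteq> T" by (elim exE conjE)
    then obtain n where "F \<subseteq> {..<n}" using finite_nat_iff_bounded by blast
    then show ?thesis using F T by (intro exI[of _ n]) blast
  qed
  then have "\<forall>x\<in>S. \<exists>n. \<forall>y\<in>S. (\<forall>i<n. y i = x i) \<longrightarrow> f y = f x" by (rule ballI)
  from bchoice[OF this] obtain r
    where r: "\<forall>x\<in>S. \<forall>y\<in>S. (\<forall>i<r x. y i = x i) \<longrightarrow> f y = f x" ..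
  have cover: "S \<subseteq> (\<Union>x\<in>S. {y. \<forall>i\<in>{..<r x}. y i = x i})" by auto
  have opn: "open {y. \<forall>i\<in>{..<r x}. y i = x i}" for x by (rule open_cylinder) simp
  obtain C where C: "C \<subseteq> S" "finite C" "S \<subseteq> (\<Union>x\<in>C. {y. \<forall>i\<in>{..<r x}. y i = x i})"
    by (rule compactE_image[OF assms(1) opn cover])
  have "f x = f y" if xy: "x \<in> S" "y \<in> S" "\<forall>i<Max (r ` C). x i = y i" for x y
  proof -
    obtain z where z: "z \<in> C" "\<forall>i<r z. x i = z i" using subsetD[OF C(3) xy(1)] by auto
    then have "r z \<le> Max (r ` C)" using C(2) by simp
    then have "\<forall>i<r z. y i = z i" using z xy(3) by (metis order_less_le_trans)
    then show ?thesis using r z C(1) xy(1,2) by (metis subsetD)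
  qed
  then show ?thesis by blast
qed

lemma compact_bounded_nat:
  fixes f :: "'a::topological_space \<Rightarrow> nat"
  assumes "compact S" "continuous_on S f"
  shows "\<exists>b. \<forall>x\<in>S. f x \<le> b"
proof (cases "S = {}")
  case False
  then show ?thesis using continuous_attains_sup[OF assms(1) _ assms(2)] by blast
qed simp

lemma compact_bounded_int:
  fixes f :: "'a::topological_space \<Rightarrow> int"
  assumes "compact S" "continuous_on S f"
  shows "\<exists>b::nat. \<forall>x\<in>S. \<bar>f x\<bar> \<le> int b"
proof (cases "S = {}")
  case False
  from continuous_attains_sup[OF assms(1) this assms(2)] continuous_attains_inf[OF assms(1) this assms(2)]
  obtain u v where "\<forall>x\<in>S. f x \<le> u \<and> v \<le> f x" by blast
  then have "\<forall>x\<in>S. \<bar>f x\<bar> \<le> int (nat (max \<bar>u\<bar> \<bar>v\<bar>))" by force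
  then show ?thesis by blast
qed simp

lemma continuous_on_discrete_compose:
  fixes f :: "'a::topological_space \<Rightarrow> 'b::discrete_topology" and g :: "'b \<Rightarrow> 'c::topological_space"
  assumes "continuous_on S f"
  shows "continuous_on S (\<lambda>x. g (f x))"
  by (rule continuous_on_compose2[OF _ assms, of UNIV]) (auto simp: continuous_on_open_vimage open_discrete)

lemma continuous_on_int_diff:
  fixes f g :: "'a::topological_space \<Rightarrow> int"
  assumes "continuous_on S f" "continuous_on S g"
  shows "continuous_on S (\<lambda>x. f x - g x)"
  using continuous_on_add[OF assms(1) continuous_on_int_uminus[OF assms(2)]] by simp

text \<open>The index \<open>l\<close> is locally constant, so near each point only one
  \<open>F n\<close> is involved. This handles sums whose length, and letters whose position, vary
  with the point.\<close>

lemma continuous_on_discrete_index: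
  fixes l :: "'a::topological_space \<Rightarrow> 'i::discrete_topology" and F :: "'i \<Rightarrow> 'a \<Rightarrow> 'b::topological_space"
  assumes l: "continuous_on S l" and F: "\<And>n. continuous_on S (F n)"
  shows "continuous_on S (\<lambda>x. F (l x) x)"
  unfolding continuous_on_def
proof
  fix x assume x: "x \<in> S"
  have "(l \<longlongrightarrow> l x) (at x within S)" using l x by (simp add: continuous_on_def)
  then have "eventually (\<lambda>y. l y \<in> {l x}) (at x within S)"
    by (rule topological_tendstoD) (auto simp: open_discrete)
  then have "eventually (\<lambda>y. F (l x) y = F (l y) y) (at x within S)"
    by eventually_elim simp
  moreover have "(F (l x) \<longlongrightarrow> F (l x) x) (at x within S)"
    using F x by (simp add: continuous_on_def)
  ultimately show "((\<lambda>y. F (l y) y) \<longlongrightarrow> F (l x) x) (at x within S)"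
    by (rule Lim_transform_eventually[rotated])
qed

lemma closed_of_discrete: "closed (S :: 'a::discrete_topology set)"
  by (simp add: closed_def open_discrete)

lemma continuous_on_coordinate: "continuous_on S (\<lambda>x::'i \<Rightarrow> 'b::topological_space. x i)"
  using continuous_on_product_coordinates by (rule continuous_on_subset) simp

text \<open>Tychonoff's theorem together with closed conditions on two coordinates each. The
  arbitrary successor \<open>s\<close> lets one statement cover both index types.\<close>

lemma compact_subshift:
  fixes s :: "'i \<Rightarrow> 'i" and P :: "nat \<Rightarrow> nat \<Rightarrow> bool"
  shows "compact {x :: 'i \<Rightarrow> nat. (\<forall>i. x i < N) \<and> (\<forall>i. P (x i) (x (s i)))}"
proof -
  have "compactin (product_topology (\<lambda>i::'i. euclidean) UNIV) (PiE UNIV (\<lambda>i. {..<N}))"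
    by (auto simp: compactin_PiE intro!: finite_imp_compact)
  then have "compact (PiE UNIV (\<lambda>i::'i. {..<N}))"
    by (simp add: euclidean_product_topology)
  then have *: "compact {x :: 'i \<Rightarrow> nat. \<forall>i. x i < N}"
    by (simp add: PiE_UNIV_domain Collect_conj_eq Pi_def)
  have "closed {x :: 'i \<Rightarrow> nat. P (x i) (x (s i))}" for i
  proof -
    have "continuous_on UNIV (\<lambda>x::'i \<Rightarrow> nat. P (x i) (x (s i)))"
      by (rule continuous_on_finite_window) (auto intro!: exI[of _ "{i, s i}"])
    then have "closed ((\<lambda>x::'i \<Rightarrow> nat. P (x i) (x (s i))) -` {True})"
      by (intro closed_vimage) (simp_all add: closed_singleton)
    then show ?thesis by (simp add: vimage_def)
  qed
  then have "closed {x :: 'i \<Rightarrow> nat. \<forall>i. P (x i) (x (s i))}"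
    by (rule closed_Collect_all)
  from compact_Int_closed[OF * this] show ?thesis by (simp add: Collect_conj_eq)
qed

lemma compact_one_sided_shift: "compact (one_sided_shift A)"
  unfolding one_sided_shift_def by (rule compact_subshift)

lemma compact_two_sided_shift: "compact (two_sided_shift A)"
  unfolding two_sided_shift_def by (rule compact_subshift)

lemma continuous_on_funpow_shift: "continuous_on S (shift_map ^^ n)"
  unfolding funpow_shift_map
  by (intro continuous_on_coordinatewise_then_product continuous_on_coordinate)

text \<open>Under condition (I) a nonempty cylinder is a perfect compact Hausdorff space, hence
  uncountable, whereas eventually periodic points form a countable set.\<close>

lemma dense_not_eventually_periodic:
  assumes I: "condition_I A" and x: "x \<in> one_sided_shift A"
  shows "\<exists>z\<in>one_sided_shift A. (\<forall>i<n. z i = x i) \<and>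
           (\<forall>i j. (shift_map ^^ i) z = (shift_map ^^ j) z \<longrightarrow> i = j)"
proof (rule ccontr)
  assume none: "\<not> ?thesis"
  let ?X = "one_sided_shift A"
  define U where "U = {z. \<forall>i\<in>{..<n}. z i = x i}"
  have U: "open U" unfolding U_def by (rule open_cylinder) simp
  define E where "E = (\<lambda>(i, j). {z \<in> ?X. i < j \<and> (shift_map ^^ i) z = (shift_map ^^ j) z})"
  have sub: "U \<inter> ?X \<subseteq> (\<Union>p. E p)"
  proof (intro subsetI)
    fix z assume "z \<in> U \<inter> ?X"
    then obtain i j where "z \<in> ?X" "(shift_map ^^ i) z = (shift_map ^^ j) z" "i \<noteq> j"
      using none by (auto simp: U_def)
    then have "z \<in> E (min i j, max i j)" by (auto simp: E_def min_def max_def)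
    then show "z \<in> (\<Union>p. E p)" by blast
  qed
  have "finite (E (i, j))" for i j
  proof (cases "i < j")
    case True
    \<comment> \<open>From position \<open>j\<close> on, each letter of a point of
      \<open>E (i, j)\<close> repeats the letter \<open>j - i\<close> places earlier, so the first
      \<open>j\<close> letters determine the point.\<close>
    have "inj_on (\<lambda>z. restrict z {..<j}) (E (i, j))"
    proof (rule inj_onI)
      fix y z assume y: "y \<in> E (i, j)" and z: "z \<in> E (i, j)"
        and eq: "restrict y {..<j} = restrict z {..<j}"
      have "y t = z t" for t
      proof (induction t rule: less_induct)
        case (less t)
        show ?case
        proof (cases "t < j")
          case True
          then show ?thesis using fun_cong[OF eq, of t] by simp
        next
          case False
          have "w t = w (t - j + i)" if "w \<in> E (i, j)" for w
            using that False unfolding E_def funpow_shift_map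
            by (auto dest!: fun_cong[of _ _ "t - j"])
          then show ?thesis using less[of "t - j + i"] y z \<open>i < j\<close> False
            by (metis add.commute add_diff_inverse_nat add_less_cancel_right)
        qed
      qed
      then show "y = z" by blast
    qed
    moreover have "finite ((\<lambda>z. restrict z {..<j}) ` E (i, j))"
      by (rule finite_subset[of _ "{..<j} \<rightarrow>\<^sub>E {..<dim_row A}"])
         (auto simp: E_def one_sided_shift_def intro: finite_PiE split: if_splits)
    ultimately show ?thesis by (rule finite_imageD[rotated])
  qed (auto simp: E_def)
  then have "countable (\<Union>p. E p)"
    by (intro countable_UN) (auto simp: countable_finite)
  then have count: "countable (U \<inter> ?X)" using sub by (rule countable_subset[rotated])
  have "closed ((\<lambda>z. z i) -` {x i})" for i :: nat
    by (intro closed_vimage closed_of_discrete continuous_on_coordinate)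
  then have "closed (\<Inter>i\<in>{..<n}. (\<lambda>z. z i) -` {x i})"
    by (intro closed_INT) auto
  also have "(\<Inter>i\<in>{..<n}. (\<lambda>z. z i) -` {x i}) = U" by (auto simp: U_def)
  finally have "compact (U \<inter> ?X)"
    using compact_one_sided_shift by (rule closed_Int_compact)
  then have "locally_compact_space (top_of_set (U \<inter> ?X))" "Hausdorff_space (top_of_set (U \<inter> ?X))"
    by (simp_all add: compact_imp_locally_compact_space compact_space_subtopology
        Hausdorff_space_subtopology Hausdorff_space_t2)
  moreover have "(top_of_set (U \<inter> ?X)) derived_set_of (U \<inter> ?X) = U \<inter> ?X"
  proof (intro subset_antisym subsetI)
    fix z assume z: "z \<in> U \<inter> ?X"
    have "\<exists>y. y \<noteq> z \<and> y \<in> U \<inter> ?X \<and> y \<in> T" if T: "z \<in> T" "openin (top_of_set (U \<inter> ?X)) T" for T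
    proof -
      obtain W where W: "open W" "T = (U \<inter> ?X) \<inter> W" using T(2) by (auto simp: openin_open)
      have "\<not> z isolated_in ?X" using I z by (simp add: condition_I_def)
      moreover have "open (U \<inter> W)" using U W by auto
      ultimately have "(U \<inter> W) \<inter> ?X \<noteq> {z}" using z by (auto simp: isolated_in_def)
      then show ?thesis using W T z by blast
    qed
    then show "z \<in> (top_of_set (U \<inter> ?X)) derived_set_of (U \<inter> ?X)"
      using z by (auto simp: in_derived_set_of)
  qed (auto simp: in_derived_set_of)
  moreover have "U \<inter> ?X \<noteq> {}" using x by (auto simp: U_def)
  ultimately have "(UNIV :: real set) \<lesssim> U \<inter> ?X"
    by (intro lepoll_perfect_set) auto
  then show False
    using count by (meson countable_lepoll uncountable_UNIV_real)
qed

section \<open>Birkhoff sums and cohomology\<close>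

definition birkhoff_sum :: "((nat \<Rightarrow> nat) \<Rightarrow> int) \<Rightarrow> nat \<Rightarrow> (nat \<Rightarrow> nat) \<Rightarrow> int" where
  "birkhoff_sum f n x = (\<Sum>i<n. f ((shift_map ^^ i) x))"

lemma birkhoff_sum_0 [simp]: "birkhoff_sum f 0 x = 0"
  by (simp add: birkhoff_sum_def)

lemma birkhoff_sum_1 [simp]: "birkhoff_sum f (Suc 0) x = f x"
  by (simp add: birkhoff_sum_def)

lemma birkhoff_sum_add:
  "birkhoff_sum f (m + n) x = birkhoff_sum f m x + birkhoff_sum f n ((shift_map ^^ m) x)"
  by (induction n) (auto simp: birkhoff_sum_def funpow_add add.commute)

lemma birkhoff_sum_Suc: "birkhoff_sum f (Suc n) x = birkhoff_sum f n x + f ((shift_map ^^ n) x)"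
  by (simp add: birkhoff_sum_def)

lemma birkhoff_sum_Suc2: "birkhoff_sum f (Suc n) x = f x + birkhoff_sum f n (shift_map x)"
  using birkhoff_sum_add[of f 1 n x] by simp

lemma birkhoff_sum_cong:
  assumes "\<And>x. x \<in> one_sided_shift A \<Longrightarrow> f x = g x" "x \<in> one_sided_shift A"
  shows "birkhoff_sum f n x = birkhoff_sum g n x"
  unfolding birkhoff_sum_def by (intro sum.cong refl assms funpow_shift_map_in)

lemma continuous_on_birkhoff_sum:
  assumes "continuous_on (one_sided_shift A) f"
  shows "continuous_on (one_sided_shift A) (birkhoff_sum f n)"
  unfolding birkhoff_sum_def
  by (intro continuous_on_sum continuous_on_compose2[OF assms] continuous_on_funpow_shift)
     (auto intro: funpow_shift_map_in)

section \<open>Functions of finitely many letters\<close>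

definition local_on :: "nat mat \<Rightarrow> nat \<Rightarrow> ((nat \<Rightarrow> nat) \<Rightarrow> 'b) \<Rightarrow> bool" where
  "local_on A R f \<longleftrightarrow>
     (\<forall>x\<in>one_sided_shift A. \<forall>y\<in>one_sided_shift A. (\<forall>i<R. x i = y i) \<longrightarrow> f x = f y)"

lemma local_onD:
  "local_on A R f \<Longrightarrow> x \<in> one_sided_shift A \<Longrightarrow> y \<in> one_sided_shift A \<Longrightarrow>
     (\<And>i. i < R \<Longrightarrow> x i = y i) \<Longrightarrow> f x = f y"
  unfolding local_on_def by blast

lemma local_on_mono: "local_on A R f \<Longrightarrow> R \<le> R' \<Longrightarrow> local_on A R' f"
  unfolding local_on_def by (meson order_less_le_trans)

lemma local_on_imp_continuous: "local_on A R f \<Longrightarrow> continuous_on (one_sided_shift A) f"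
  for f :: "(nat \<Rightarrow> nat) \<Rightarrow> 'b::topological_space"
proof (rule continuous_on_finite_window)
  fix x assume f: "local_on A R f" and x: "x \<in> one_sided_shift A"
  have "f y = f x" if "y \<in> one_sided_shift A" "\<forall>i\<in>{..<R}. y i = x i" for y
    using that by (intro local_onD[OF f _ x]) auto
  then show "\<exists>F. finite F \<and> (\<forall>y\<in>one_sided_shift A. (\<forall>i\<in>F. y i = x i) \<longrightarrow> f y = f x)"
    by (intro exI[of _ "{..<R}"]) simp
qed

lemma continuous_imp_local_on:
  fixes f :: "(nat \<Rightarrow> nat) \<Rightarrow> 'b::discrete_topology"
  assumes "continuous_on (one_sided_shift A) f"
  obtains R where "1 \<le> R" "local_on A R f"
proof -
  obtain n where "local_on A n f"
    using compact_uniform_window[OF compact_one_sided_shift assms] unfolding local_on_def by blast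
  \<comment> \<open>Taking \<open>Suc n\<close> makes the window nonempty: points with equal windows
    then share their first letter, which is what splicing requires.\<close>
  then show thesis using local_on_mono[of A n f "Suc n"] that[of "Suc n"] by auto
qed

lemma birkhoff_sum_local:
  assumes "local_on A R f" "x \<in> one_sided_shift A" "y \<in> one_sided_shift A"
    and "\<And>i. i < n + R \<Longrightarrow> x i = y i"
  shows "birkhoff_sum f n x = birkhoff_sum f n y"
  unfolding birkhoff_sum_def
proof (intro sum.cong refl)
  fix i assume "i \<in> {..<n}"
  then show "f ((shift_map ^^ i) x) = f ((shift_map ^^ i) y)"
    using assms by (intro local_onD[OF assms(1)] funpow_shift_map_in) (auto simp: funpow_shift_map)
qed

section \<open>Cutting and pasting orbit segments\<close>

definition splice :: "(nat \<Rightarrow> nat) \<Rightarrow> nat \<Rightarrow> (nat \<Rightarrow> nat) \<Rightarrow> (nat \<Rightarrow> nat)" where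
  "splice u n y = (\<lambda>i. if i < n then u i else y (i - n))"

text \<open>At the seam the transition from \<open>u (n - 1)\<close> to \<open>y 0\<close> is the
  transition from \<open>u (n - 1)\<close> to \<open>u n\<close>, which is admissible in
  \<open>u\<close>.\<close>

lemma splice_in:
  assumes "u \<in> one_sided_shift A" "y \<in> one_sided_shift A" "u n = y 0"
  shows "splice u n y \<in> one_sided_shift A"
proof -
  have "A $$ (splice u n y i, splice u n y (i + 1)) = 1" for i
  proof (cases "i + 1 = n")
    case True
    then have "A $$ (u i, u n) = 1" using assms(1) by (auto simp: one_sided_shift_def)
    then show ?thesis using True assms(3) by (auto simp: splice_def)
  qed (use assms in \<open>auto simp: splice_def one_sided_shift_def Suc_diff_le not_less\<close>)
  then show ?thesis using assms by (auto simp: splice_def one_sided_shift_def)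
qed

lemma funpow_shift_splice: "(shift_map ^^ n) (splice u n y) = y"
  by (auto simp: funpow_shift_map splice_def)

text \<open>
  Removing a short cycle from an orbit segment does not increase its sum, so a shortest segment
  below a given value has bounded length.
\<close>

lemma birkhoff_sum_bounded_below:
  assumes R: "1 \<le> R"
  shows "\<exists>V\<ge>1. \<forall>f. local_on A R f \<longrightarrow>
      (\<forall>x\<in>one_sided_shift A. \<forall>p\<in>{1..V}. (shift_map ^^ p) x = x \<longrightarrow> 0 \<le> birkhoff_sum f p x) \<longrightarrow>
      (\<exists>M::nat. \<forall>x\<in>one_sided_shift A. \<forall>n. - int M \<le> birkhoff_sum f n x)"
proof -
  let ?X = "one_sided_shift A"
  define W where "W = (\<lambda>x. restrict x {..<R}) ` ?X"
  have finW: "finite W"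
    by (rule finite_subset[of _ "{..<R} \<rightarrow>\<^sub>E {..<dim_row A}"])
       (auto simp: W_def one_sided_shift_def intro: finite_PiE split: if_splits)
  \<comment> \<open>\<open>W\<close> is the set of words of length \<open>R\<close>, so among
    \<open>V\<close> successive windows two coincide. \<open>V\<close> depends on \<open>A\<close>
    and \<open>R\<close> only; it precedes \<open>f\<close> in the statement so that the bound can
    be applied to a function built from \<open>V\<close> itself.\<close>
  define V where "V = Suc (card W)"
  have "\<exists>M::nat. \<forall>x\<in>?X. \<forall>n. - int M \<le> birkhoff_sum f n x"
    if f: "local_on A R f"
      and cyc: "\<And>x p. x \<in> ?X \<Longrightarrow> p \<in> {1..V} \<Longrightarrow> (shift_map ^^ p) x = x \<Longrightarrow> 0 \<le> birkhoff_sum f p x"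
    for f
  proof -
    obtain b :: nat where b: "\<And>x. x \<in> ?X \<Longrightarrow> \<bar>f x\<bar> \<le> int b"
      using compact_bounded_int[OF compact_one_sided_shift local_on_imp_continuous[OF f]] by blast
    have "- int (V * b) \<le> birkhoff_sum f n x" if "x \<in> ?X" for n x
      using that
    proof (induction n arbitrary: x rule: less_induct)
      case (less n)
      show ?case
      proof (cases "n < V")
        case True
        have "- int b \<le> f ((shift_map ^^ i) x)" for i
          using b[OF funpow_shift_map_in[OF less.prems], of i] by linarith
        then have "(\<Sum>i<n. - int b) \<le> birkhoff_sum f n x"
          unfolding birkhoff_sum_def by (intro sum_mono)
        moreover have "int n * int b \<le> int V * int b"
          using True by (intro mult_right_mono) auto
        ultimately show ?thesis by simp
      next
        case False
        have "\<not> inj_on (\<lambda>i. restrict ((shift_map ^^ i) x) {..<R}) {..card W}"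
        proof
          assume "inj_on (\<lambda>i. restrict ((shift_map ^^ i) x) {..<R}) {..card W}"
          moreover have "(\<lambda>i. restrict ((shift_map ^^ i) x) {..<R}) ` {..card W} \<subseteq> W"
            unfolding W_def using funpow_shift_map_in[OF less.prems] by blast
          ultimately have "card {..card W} \<le> card W"
            using finW by (metis card_inj_on_le)
          then show False by simp
        qed
        then obtain i j where ij: "i < j" "j \<le> card W"
            "restrict ((shift_map ^^ i) x) {..<R} = restrict ((shift_map ^^ j) x) {..<R}"
          unfolding inj_on_def by (metis atMost_iff linorder_neqE_nat)
        define q where "q = j - i"
        have q: "j = i + q" "1 \<le> q" "q \<le> V" "j \<le> n"
          using ij False by (auto simp: q_def V_def)
        have rep: "x (i + s) = x (j + s)" if "s < R" for s
          using fun_cong[OF ij(3), of s] that by (simp add: funpow_shift_map add.commute)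
        define u where "u = (shift_map ^^ i) x"
        have u: "u \<in> ?X" unfolding u_def by (rule funpow_shift_map_in[OF less.prems])
        \<comment> \<open>The periodic point that repeats the first \<open>q\<close> letters of
          \<open>u\<close>; it is admissible because \<open>u q = u 0\<close>.\<close>
        define w where "w = (\<lambda>t. u (t mod q))"
        have uq: "u q = u 0" using rep[of 0] R by (simp add: u_def funpow_shift_map q add.commute)
        have w_in: "w \<in> ?X"
        proof -
          have "A $$ (w t, w (t + 1)) = 1" for t
          proof -
            have "w (t + 1) = u (t mod q + 1)"
            proof (cases "t mod q + 1 = q")
              case True
              then have "(t + 1) mod q = 0" by (metis mod_add_left_eq mod_self)
              then show ?thesis using uq True by (simp add: w_def)
            next
              case False
              then have "t mod q + 1 < q" using q(2) by (metis Suc_eq_plus1 Suc_lessI mod_less_divisor less_eq_Suc_le One_nat_def)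
              then have "(t + 1) mod q = t mod q + 1" by (metis mod_add_left_eq mod_less)
              then show ?thesis by (simp add: w_def)
            qed
            then show ?thesis using u by (simp add: w_def one_sided_shift_def)
          qed
          then show ?thesis using u by (simp add: w_def one_sided_shift_def)
        qed
        have per: "(shift_map ^^ q) w = w" by (simp add: funpow_shift_map w_def)
        \<comment> \<open>The \<open>R\<close> letters beyond the period matter: \<open>f\<close>
          sees them in the last of the \<open>q\<close> terms. They agree because the windows at
          times \<open>i\<close> and \<open>j\<close> do.\<close>
        have uw: "u t = w t" if "t < q + R" for t
          using that
        proof (induction t rule: less_induct)
          case (less t)
          show ?case
          proof (cases "t < q")
            case False
            then have "u t = u (t - q)"
              using rep[of "t - q"] less.prems by (simp add: u_def funpow_shift_map q add.commute add.left_commute)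
            moreover have "w t = w (t - q)" using False by (simp add: w_def le_mod_geq)
            ultimately show ?thesis using less.IH[of "t - q"] less.prems False q(2) by simp
          qed (simp add: w_def)
        qed
        have cw: "0 \<le> birkhoff_sum f q u"
          using cyc[OF w_in _ per] q birkhoff_sum_local[OF f u w_in uw] by simp
        define z where "z = (shift_map ^^ j) x"
        have z: "z \<in> ?X" unfolding z_def by (rule funpow_shift_map_in[OF less.prems])
        \<comment> \<open>The orbit with the stretch from time \<open>i\<close> to time
          \<open>j\<close> cut out. Equality of the two windows leaves the sum before time
          \<open>i\<close> unchanged.\<close>
        define x' where "x' = splice x i z"
        have "x i = z 0" using rep[of 0] R by (simp add: z_def funpow_shift_map)
        then have x': "x' \<in> ?X" unfolding x'_def using less.prems z by (intro splice_in)
        have "birkhoff_sum f i x = birkhoff_sum f i x'"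
        proof (rule birkhoff_sum_local[OF f less.prems x'])
          fix t assume "t < i + R"
          then show "x t = x' t"
            using rep[of "t - i"] by (auto simp: x'_def splice_def z_def funpow_shift_map not_less add.commute)
        qed
        moreover have "birkhoff_sum f (n - q) x' = birkhoff_sum f i x' + birkhoff_sum f (n - j) z"
          using birkhoff_sum_add[of f i "n - j" x'] q by (simp add: x'_def funpow_shift_splice)
        moreover have "birkhoff_sum f n x = birkhoff_sum f i x + birkhoff_sum f q u + birkhoff_sum f (n - j) z"
          using birkhoff_sum_add[of f j "n - j" x] birkhoff_sum_add[of f i q x] q
          by (simp add: u_def z_def)
        ultimately have "birkhoff_sum f (n - q) x' \<le> birkhoff_sum f n x" using cw by simp
        moreover have "- int (V * b) \<le> birkhoff_sum f (n - q) x'"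
          using less.IH[OF _ x', of "n - q"] q by simp
        ultimately show ?thesis by simp
      qed
    qed
    then show ?thesis by blast
  qed
  then show ?thesis by (intro exI[of _ V]) (auto simp: V_def)
qed

text \<open>The lower bound is applied to \<open>V * f - 1\<close>. Its sum over a cycle of length
  \<open>p\<close> is at least \<open>V - p\<close>, which is nonnegative precisely in the range
  \<open>p \<le> V\<close> where the bound asks for it.\<close>

lemma birkhoff_sum_linear_growth:
  assumes f: "continuous_on (one_sided_shift A) f"
    and pos: "\<And>x p. x \<in> one_sided_shift A \<Longrightarrow> 1 \<le> p \<Longrightarrow> (shift_map ^^ p) x = x \<Longrightarrow> 1 \<le> birkhoff_sum f p x"
  shows "\<exists>V M::nat. 1 \<le> V \<and> (\<forall>x\<in>one_sided_shift A. \<forall>n. int n - int M \<le> int V * birkhoff_sum f n x)"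
proof -
  let ?X = "one_sided_shift A"
  obtain R where R: "1 \<le> R" "local_on A R f" using continuous_imp_local_on[OF f] .
  obtain V where "1 \<le> V" and V: "\<And>f. local_on A R f \<Longrightarrow>
      \<forall>x\<in>?X. \<forall>p\<in>{1..V}. (shift_map ^^ p) x = x \<longrightarrow> 0 \<le> birkhoff_sum f p x \<Longrightarrow>
      \<exists>M::nat. \<forall>x\<in>?X. \<forall>n. - int M \<le> birkhoff_sum f n x"
    using birkhoff_sum_bounded_below[OF R(1), of A] by metis
  have sum: "birkhoff_sum (\<lambda>x. int V * f x - 1) n x = int V * birkhoff_sum f n x - int n" for n x
    by (simp add: birkhoff_sum_def sum_subtractf sum_distrib_left)
  have "\<exists>M::nat. \<forall>x\<in>?X. \<forall>n. - int M \<le> birkhoff_sum (\<lambda>x. int V * f x - 1) n x"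
  proof (rule V)
    show "local_on A R (\<lambda>x. int V * f x - 1)"
      using R(2) unfolding local_on_def by metis
    show "\<forall>x\<in>?X. \<forall>p\<in>{1..V}. (shift_map ^^ p) x = x \<longrightarrow> 0 \<le> birkhoff_sum (\<lambda>x. int V * f x - 1) p x"
    proof (intro ballI impI)
      fix x p assume "x \<in> ?X" "p \<in> {1..V}" "(shift_map ^^ p) x = x"
      then have "1 \<le> birkhoff_sum f p x" using pos by simp
      then have "int V * 1 \<le> int V * birkhoff_sum f p x" by (intro mult_left_mono) auto
      then show "0 \<le> birkhoff_sum (\<lambda>x. int V * f x - 1) p x"
        using \<open>p \<in> {1..V}\<close> unfolding sum by (simp only: atLeastAtMost_iff) linarith
    qed
  qed
  then obtain M :: nat where "\<forall>x\<in>?X. \<forall>n. - int M \<le> int V * birkhoff_sum f n x - int n"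
    unfolding sum by blast
  then have "\<forall>x\<in>?X. \<forall>n. int n - int M \<le> int V * birkhoff_sum f n x"
    by (simp add: algebra_simps)
  then show ?thesis using \<open>1 \<le> V\<close> by blast
qed

text \<open>The transfer function is the least sum over all orbit segments that end at the given point.\<close>

lemma cohomologous_nonneg:
  assumes f: "continuous_on (one_sided_shift A) f"
    and nonneg: "\<And>x p. x \<in> one_sided_shift A \<Longrightarrow> 1 \<le> p \<Longrightarrow> (shift_map ^^ p) x = x \<Longrightarrow> 0 \<le> birkhoff_sum f p x"
  shows "\<exists>b. continuous_on (one_sided_shift A) b \<and>
           (\<forall>x\<in>one_sided_shift A. 0 \<le> f x + b x - b (shift_map x))"
proof -
  let ?X = "one_sided_shift A"
  obtain R where R: "1 \<le> R" "local_on A R f" using continuous_imp_local_on[OF f] .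
  have "\<exists>M::nat. \<forall>x\<in>?X. \<forall>n. - int M \<le> birkhoff_sum f n x"
    using birkhoff_sum_bounded_below[OF R(1), of A] R(2) nonneg by (metis atLeastAtMost_iff)
  then obtain M :: nat where M: "\<And>x n. x \<in> ?X \<Longrightarrow> - int M \<le> birkhoff_sum f n x" by blast
  \<comment> \<open>The end of a segment is prescribed only through its first \<open>R\<close>
    letters, so \<open>Q\<close>, and with it the infimum \<open>b\<close>, depends on these letters
    alone and is continuous.\<close>
  define Q where "Q = (\<lambda>x. {birkhoff_sum f n z | n z. z \<in> ?X \<and> (\<forall>i<R. z (n + i) = x i)})"
  define b where "b = (\<lambda>x. Inf (Q x))"
  have bdd: "bdd_below (Q x)" for x
    by (rule bdd_belowI[of _ "- int M"]) (auto simp: Q_def M)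
  have ne: "Q x \<noteq> {}" if "x \<in> ?X" for x
  proof -
    have "birkhoff_sum f 0 x \<in> Q x" using that unfolding Q_def by (intro CollectI exI[of _ 0] exI[of _ x]) simp
    then show ?thesis by blast
  qed
  have "local_on A R b"
    unfolding local_on_def b_def Q_def by (auto intro!: arg_cong[where f = Inf])
  then have "continuous_on ?X b" by (rule local_on_imp_continuous)
  moreover have "b (shift_map x) \<le> f x + b x" if x: "x \<in> ?X" for x
  proof -
    have "b (shift_map x) - f x \<le> q" if "q \<in> Q x" for q
    proof -
      obtain n z where z: "q = birkhoff_sum f n z" "z \<in> ?X" "\<And>i. i < R \<Longrightarrow> z (n + i) = x i"
        using \<open>q \<in> Q x\<close> unfolding Q_def by blast
      \<comment> \<open>Replacing the continuation of \<open>z\<close> by \<open>x\<close> itself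
        keeps the sum \<open>q\<close>. One further step then adds exactly \<open>f x\<close> and
        ends at \<open>shift_map x\<close>.\<close>
      define y where "y = splice z n x"
      have y: "y \<in> ?X" unfolding y_def using z(2) z(3)[of 0] R(1) x by (intro splice_in) auto
      have "birkhoff_sum f n z = birkhoff_sum f n y"
      proof (rule birkhoff_sum_local[OF R(2) z(2) y])
        fix t assume "t < n + R"
        then show "z t = y t" using z(3)[of "t - n"] by (auto simp: y_def splice_def not_less)
      qed
      then have "birkhoff_sum f (Suc n) y = q + f x"
        by (simp add: birkhoff_sum_Suc y_def funpow_shift_splice z(1))
      moreover have "birkhoff_sum f (Suc n) y \<in> Q (shift_map x)"
        unfolding Q_def using y
        by (intro CollectI exI[of _ "Suc n"] exI[of _ y]) (auto simp: y_def splice_def shift_map_def)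
      ultimately have "b (shift_map x) \<le> q + f x"
        unfolding b_def by (metis cInf_lower bdd)
      then show ?thesis by simp
    qed
    then have "b (shift_map x) - f x \<le> b x"
      unfolding b_def using ne[OF x] by (intro cInf_greatest) 
    then show ?thesis by simp
  qed
  ultimately show ?thesis by (intro exI[of _ b]) (auto simp: algebra_simps)
qed

section \<open>Lag functions of continuous orbit maps\<close>

lemma funpow_shift_shift: "(shift_map ^^ m) ((shift_map ^^ n) x) = (shift_map ^^ (m + n)) x"
  by (simp add: funpow_add)

text \<open>The triple \<open>(y, n, y')\<close> is an arrow of the Deaconu-Renault groupoid of the
  shift, and \<open>v\<close> is the value on it of the cocycle determined by \<open>f\<close>.
  Reflexivity, symmetry and transitivity below are units, inverses and composition.\<close>

definition tail_related ::
    "((nat \<Rightarrow> nat) \<Rightarrow> int) \<Rightarrow> (nat \<Rightarrow> nat) \<Rightarrow> (nat \<Rightarrow> nat) \<Rightarrow> int \<Rightarrow> int \<Rightarrow> bool" where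
  "tail_related f y y' n v \<longleftrightarrow>
     (\<exists>i j. (shift_map ^^ i) y = (shift_map ^^ j) y' \<and> n = int i - int j \<and>
            v = birkhoff_sum f i y - birkhoff_sum f j y')"

lemma tail_relatedI:
  "(shift_map ^^ i) y = (shift_map ^^ j) y' \<Longrightarrow> n = int i - int j \<Longrightarrow>
     v = birkhoff_sum f i y - birkhoff_sum f j y' \<Longrightarrow> tail_related f y y' n v"
  unfolding tail_related_def by blast

lemma tail_related_refl: "tail_related f y y 0 0"
  by (rule tail_relatedI[of 0 _ 0]) auto

lemma tail_related_sym: "tail_related f y y' n v \<Longrightarrow> tail_related f y' y (- n) (- v)"
  unfolding tail_related_def by (metis minus_diff_eq)

lemma tail_related_trans:
  assumes "tail_related f y y' n v" "tail_related f y' y'' m w"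
  shows "tail_related f y y'' (n + m) (v + w)"
proof -
  obtain i j where ij: "(shift_map ^^ i) y = (shift_map ^^ j) y'" "n = int i - int j"
      "v = birkhoff_sum f i y - birkhoff_sum f j y'"
    using assms(1) unfolding tail_related_def by blast
  obtain p q where pq: "(shift_map ^^ p) y' = (shift_map ^^ q) y''" "m = int p - int q"
      "w = birkhoff_sum f p y' - birkhoff_sum f q y''"
    using assms(2) unfolding tail_related_def by blast
  have "(shift_map ^^ (i + p)) y = (shift_map ^^ (p + j)) y'"
    using ij(1) by (metis funpow_shift_shift add.commute)
  also have "\<dots> = (shift_map ^^ (q + j)) y''"
    using pq(1) by (metis funpow_shift_shift add.commute)
  finally show ?thesis
  proof (rule tail_relatedI)
    have "birkhoff_sum f (j + p) y' = birkhoff_sum f (p + j) y'" by (simp add: add.commute)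
    then have "birkhoff_sum f j y' + birkhoff_sum f p ((shift_map ^^ i) y) =
          birkhoff_sum f p y' + birkhoff_sum f j ((shift_map ^^ q) y'')"
      by (simp only: birkhoff_sum_add ij(1) pq(1))
    then show "v + w = birkhoff_sum f (i + p) y - birkhoff_sum f (q + j) y''"
      using ij(3) pq(3) by (simp add: birkhoff_sum_add)
  qed (use ij(2) pq(2) in simp)
qed

lemma tail_related_funpow: "tail_related f y ((shift_map ^^ n) y) (int n) (birkhoff_sum f n y)"
  by (rule tail_relatedI[of n _ 0]) auto

text \<open>Two witness pairs with the same difference differ by a common number of steps, which lie
  on the common tail and contribute equally to both sums.\<close>

lemma tail_related_unique:
  assumes "tail_related f y y' n v" "tail_related f y y' n w"
  shows "v = w"
proof -
  have *: "v = w" if ij: "(shift_map ^^ i) y = (shift_map ^^ j) y'" "n = int i - int j"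
      "v = birkhoff_sum f i y - birkhoff_sum f j y'"
    and pq: "n = int p - int q" "w = birkhoff_sum f p y - birkhoff_sum f q y'" and "i \<le> p"
    for i j p q v w
  proof -
    obtain t where "p = i + t" using \<open>i \<le> p\<close> le_Suc_ex by blast
    then have "q = j + t" using ij(2) pq(1) by simp
    then show ?thesis unfolding ij(3) pq(2) \<open>p = i + t\<close> by (simp add: birkhoff_sum_add ij(1))
  qed
  obtain i j where ij: "(shift_map ^^ i) y = (shift_map ^^ j) y'" "n = int i - int j"
      "v = birkhoff_sum f i y - birkhoff_sum f j y'"
    using assms(1) unfolding tail_related_def by blast
  obtain p q where pq: "(shift_map ^^ p) y = (shift_map ^^ q) y'" "n = int p - int q"
      "w = birkhoff_sum f p y - birkhoff_sum f q y'"
    using assms(2) unfolding tail_related_def by blast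
  show ?thesis using *[OF ij pq(2,3)] *[OF pq ij(2,3)] linear[of i p] by auto
qed

text \<open>Two lags would give an arrow from \<open>y\<close> to itself with lag
  \<open>n - m\<close>; a point that is not eventually periodic has trivial isotropy.\<close>

lemma tail_related_lag_unique:
  assumes "tail_related f y y' n v" "tail_related f y y' m w"
    and per: "\<And>i j. (shift_map ^^ i) y = (shift_map ^^ j) y \<Longrightarrow> i = j"
  shows "n = m"
proof -
  have "tail_related f y y (n + - m) (v + - w)"
    using tail_related_trans[OF assms(1) tail_related_sym[OF assms(2)]] .
  then obtain i j where "(shift_map ^^ i) y = (shift_map ^^ j) y" "n + - m = int i - int j"
    unfolding tail_related_def by blast
  then show ?thesis using per[of i j] by simp
qed

lemma birkhoff_sum_mono_nonneg:
  assumes "\<And>x. x \<in> one_sided_shift A \<Longrightarrow> 0 \<le> f x" "y \<in> one_sided_shift A" "j \<le> i"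
  shows "birkhoff_sum f j y \<le> birkhoff_sum f i y"
  unfolding birkhoff_sum_def
  by (rule sum_mono2) (use assms in \<open>auto intro: funpow_shift_map_in\<close>)

lemma tail_related_nonneg:
  assumes "\<And>x. x \<in> one_sided_shift A \<Longrightarrow> 0 \<le> f x" "y \<in> one_sided_shift A"
    and "tail_related f y y n v" "0 \<le> n"
  shows "0 \<le> v"
proof -
  obtain i j where "n = int i - int j" "v = birkhoff_sum f i y - birkhoff_sum f j y"
    using assms(3) unfolding tail_related_def by blast
  then show ?thesis using birkhoff_sum_mono_nonneg[OF assms(1,2), where i = i and j = j] assms(4) by simp
qed

text \<open>One direction of a continuous orbit equivalence, kept separate so that all results hold
  for the map and for its inverse by two instantiations.\<close>

locale orbit_map =
  fixes A B :: "nat mat" and h :: "(nat \<Rightarrow> nat) \<Rightarrow> nat \<Rightarrow> nat" and k l :: "(nat \<Rightarrow> nat) \<Rightarrow> nat"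
  assumes condition_I: "condition_I A"
    and h_cont: "continuous_on (one_sided_shift A) h"
    and h_in: "x \<in> one_sided_shift A \<Longrightarrow> h x \<in> one_sided_shift B"
    and h_inj: "inj_on h (one_sided_shift A)"
    and k_cont: "continuous_on (one_sided_shift A) k"
    and l_cont: "continuous_on (one_sided_shift A) l"
    and h_shift: "x \<in> one_sided_shift A \<Longrightarrow>
      (shift_map ^^ k x) (h (shift_map x)) = (shift_map ^^ l x) (h x)"
begin

text \<open>The cocycle of \<open>f\<close> on the arrow from \<open>h x\<close> to
  \<open>h (shift_map x)\<close> with lag \<open>l x - k x\<close>. The subtracted sum accounts for
  the orbits meeting only after \<open>k x\<close> steps beyond
  \<open>h (shift_map x)\<close>.\<close>

definition pull :: "((nat \<Rightarrow> nat) \<Rightarrow> int) \<Rightarrow> (nat \<Rightarrow> nat) \<Rightarrow> int" where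
  "pull f x = birkhoff_sum f (l x) (h x) - birkhoff_sum f (k x) (h (shift_map x))"

definition lag :: "(nat \<Rightarrow> nat) \<Rightarrow> int" where
  "lag x = int (l x) - int (k x)"

lemma pull_const: "pull (\<lambda>x. 1) x = lag x"
  by (simp add: pull_def lag_def birkhoff_sum_def)

lemma tail_related_pull:
  assumes "x \<in> one_sided_shift A"
  shows "tail_related f (h x) (h (shift_map x)) (lag x) (pull f x)"
  unfolding lag_def pull_def by (rule tail_relatedI[OF h_shift[OF assms, symmetric] refl refl])

lemma tail_related_pull_funpow:
  assumes "x \<in> one_sided_shift A"
  shows "tail_related f (h x) (h ((shift_map ^^ n) x)) (birkhoff_sum lag n x) (birkhoff_sum (pull f) n x)"
proof (induction n)
  case 0
  show ?case by (simp add: tail_related_refl)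
next
  case (Suc n)
  from tail_related_trans[OF Suc.IH tail_related_pull[OF funpow_shift_map_in[OF assms]]]
  show ?case by (simp add: birkhoff_sum_Suc)
qed

text \<open>The lag \<open>m\<close> is left unspecified; it is identified later at points whose
  isotropy is trivial.\<close>

lemma tail_related_pull_general:
  assumes "tail_related (pull f) x x' n v" "x \<in> one_sided_shift A" "x' \<in> one_sided_shift A"
  shows "\<exists>m. tail_related f (h x) (h x') m v"
proof -
  obtain i j where ij: "(shift_map ^^ i) x = (shift_map ^^ j) x'"
      "v = birkhoff_sum (pull f) i x - birkhoff_sum (pull f) j x'"
    using assms(1) unfolding tail_related_def by blast
  have "tail_related f (h ((shift_map ^^ i) x)) (h x')
      (- birkhoff_sum lag j x') (- birkhoff_sum (pull f) j x')"
    unfolding ij(1) by (rule tail_related_sym[OF tail_related_pull_funpow[OF assms(3)]])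
  from tail_related_trans[OF tail_related_pull_funpow[OF assms(2)] this] show ?thesis
    using ij(2) by auto
qed

lemma continuous_on_h_shift: "continuous_on (one_sided_shift A) (\<lambda>x. h (shift_map x))"
  by (rule continuous_on_compose2[OF h_cont continuous_on_subset[OF continuous_shift_map]])
     (auto intro: shift_map_in)

lemma continuous_on_pull:
  assumes "continuous_on (one_sided_shift B) f"
  shows "continuous_on (one_sided_shift A) (pull f)"
  unfolding pull_def
proof (intro continuous_on_int_diff)
  note bs = continuous_on_birkhoff_sum[OF assms]
  show "continuous_on (one_sided_shift A) (\<lambda>x. birkhoff_sum f (l x) (h x))"
    by (rule continuous_on_discrete_index[OF l_cont, where F = "\<lambda>n x. birkhoff_sum f n (h x)"])
       (rule continuous_on_compose2[OF bs h_cont], auto intro: h_in)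
  show "continuous_on (one_sided_shift A) (\<lambda>x. birkhoff_sum f (k x) (h (shift_map x)))"
    by (rule continuous_on_discrete_index[OF k_cont, where F = "\<lambda>n x. birkhoff_sum f n (h (shift_map x))"])
       (rule continuous_on_compose2[OF bs continuous_on_h_shift], auto intro: h_in shift_map_in)
qed

lemma continuous_on_lag: "continuous_on (one_sided_shift A) lag"
  using continuous_on_pull[of "\<lambda>x. 1"] pull_const by (simp add: continuous_on_const)

lemma h_window:
  "\<exists>R. \<forall>x\<in>one_sided_shift A. \<forall>y\<in>one_sided_shift A. (\<forall>i<R. x i = y i) \<longrightarrow> (\<forall>t<J. h x t = h y t)"
proof (induction J)
  case (Suc J)
  then obtain R where R: "\<forall>x\<in>one_sided_shift A. \<forall>y\<in>one_sided_shift A.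
      (\<forall>i<R. x i = y i) \<longrightarrow> (\<forall>t<J. h x t = h y t)" by blast
  have "continuous_on (one_sided_shift A) (\<lambda>x. h x J)"
    using continuous_on_compose2[OF continuous_on_coordinate h_cont subset_UNIV] .
  then obtain R' where R': "local_on A R' (\<lambda>x. h x J)"
    by (rule continuous_imp_local_on)
  show ?case
  proof (intro exI[of _ "max R R'"] ballI impI allI)
    fix x y t assume *: "x \<in> one_sided_shift A" "y \<in> one_sided_shift A"
      "\<forall>i<max R R'. x i = y i" "t < Suc J"
    show "h x t = h y t"
    proof (cases "t = J")
      case True
      then show ?thesis using local_onD[OF R' *(1,2)] *(3) by simp
    next
      case False
      have "\<forall>i<R. x i = y i" using *(3) by simp
      then show ?thesis using R[rule_format, OF *(1,2)] *(4) False by simp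
    qed
  qed
qed simp

text \<open>Since \<open>k\<close> and \<open>l\<close> are locally constant, the sums of
  \<open>l\<close> and \<open>k\<close> along the first \<open>n\<close> points of the orbit of
  \<open>x\<close> serve as exponents \<open>i\<close> and \<open>j\<close> on a whole cylinder.
  Inverse branches near \<open>x\<close> can therefore be conjugated by \<open>h\<close> with fixed
  exponents.\<close>

lemma h_shift_locally:
  assumes x: "x \<in> one_sided_shift A"
  shows "\<exists>R i j. int i - int j = birkhoff_sum lag n x \<and>
    (\<forall>z\<in>one_sided_shift A. (\<forall>t<R. z t = x t) \<longrightarrow>
       (shift_map ^^ i) (h z) = (shift_map ^^ j) (h ((shift_map ^^ n) z)))"
proof (induction n)
  case 0
  show ?case by (rule exI[of _ 0], rule exI[of _ 0], rule exI[of _ 0]) simp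
next
  case (Suc n)
  then obtain R i j where ij: "int i - int j = birkhoff_sum lag n x"
    and R: "\<And>z. z \<in> one_sided_shift A \<Longrightarrow> \<forall>t<R. z t = x t \<Longrightarrow>
       (shift_map ^^ i) (h z) = (shift_map ^^ j) (h ((shift_map ^^ n) z))" by blast
  obtain Rk where Rk: "local_on A Rk k" using continuous_imp_local_on[OF k_cont] by blast
  obtain Rl where Rl: "local_on A Rl l" using continuous_imp_local_on[OF l_cont] by blast
  let ?y = "(shift_map ^^ n) x"
  have "(shift_map ^^ (i + l ?y)) (h z) = (shift_map ^^ (j + k ?y)) (h ((shift_map ^^ Suc n) z))"
    if z: "z \<in> one_sided_shift A" "\<forall>t<max R (n + max Rk Rl). z t = x t" for z
  proof -
    let ?w = "(shift_map ^^ n) z"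
    have w: "?w \<in> one_sided_shift A" and y: "?y \<in> one_sided_shift A"
      using x z funpow_shift_map_in by blast+
    have near: "?w t = ?y t" if "t < max Rk Rl" for t
      using z(2) that by (simp add: funpow_shift_map)
    have eq: "k ?w = k ?y" "l ?w = l ?y"
      using local_onD[OF Rk w y] local_onD[OF Rl w y] near by simp_all
    have "(shift_map ^^ (i + l ?y)) (h z) = (shift_map ^^ (j + l ?y)) (h ?w)"
      using R[OF z(1)] z(2) by (metis add.commute funpow_shift_shift less_max_iff_disj)
    also have "\<dots> = (shift_map ^^ (j + k ?y)) (h (shift_map ?w))"
      using h_shift[OF w] eq by (metis funpow_shift_shift)
    finally show ?thesis by simp
  qed
  moreover have "int (i + l ?y) - int (j + k ?y) = birkhoff_sum lag (Suc n) x"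
    using ij by (simp add: birkhoff_sum_Suc lag_def)
  ultimately show ?case by blast
qed

text \<open>
  The inverse branch of \<open>\<sigma>\<^sup>p\<close> at a periodic point \<open>x\<close> contracts towards \<open>x\<close>. If the lag were not
  positive, its conjugate under \<open>h\<close> would not increase the length of agreement with \<open>h x\<close>.
\<close>

lemma lag_periodic_pos:
  assumes x: "x \<in> one_sided_shift A" and p: "1 \<le> p" "(shift_map ^^ p) x = x"
  shows "1 \<le> birkhoff_sum lag p x"
proof (rule ccontr)
  let ?X = "one_sided_shift A"
  assume neg: "\<not> 1 \<le> birkhoff_sum lag p x"
  obtain R i j where ij: "int i - int j = birkhoff_sum lag p x"
    and R: "\<And>z. z \<in> ?X \<Longrightarrow> \<forall>t<R. z t = x t \<Longrightarrow>
       (shift_map ^^ i) (h z) = (shift_map ^^ j) (h ((shift_map ^^ p) z))"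
    using h_shift_locally[OF x] by metis
  have "i \<le> j" using ij neg by linarith
  obtain R1 where R1: "\<And>z. z \<in> ?X \<Longrightarrow> \<forall>t<R1. z t = x t \<Longrightarrow> \<forall>t<j. h z t = h x t"
    using h_window[of j] x by metis
  \<comment> \<open>The successor guarantees \<open>z 0 = x 0\<close>, so that periods of
    \<open>x\<close> can be spliced in front of \<open>z\<close>.\<close>
  define r0 where "r0 = Suc (max R R1)"
  have "\<not> x isolated_in ?X" using condition_I x by (simp add: condition_I_def)
  then have "{z. \<forall>t\<in>{..<r0}. z t = x t} \<inter> ?X \<noteq> {x}"
    using x open_cylinder[of "{..<r0}" x] unfolding isolated_in_def by blast
  then obtain z where z: "z \<in> ?X" "z \<noteq> x" "\<And>t. t < r0 \<Longrightarrow> z t = x t" using x by auto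
  have per: "x (t + r * p) = x t" for t r
  proof (induction r)
    case (Suc r)
    have "x (t + r * p + p) = x (t + r * p)"
      using fun_cong[OF p(2), of "t + r * p"] by (simp add: funpow_shift_map)
    then show ?case using Suc by (simp add: algebra_simps)
  qed simp
  \<comment> \<open>The images of \<open>z\<close> under the iterated inverse branch:
    \<open>r\<close> periods of \<open>x\<close> followed by \<open>z\<close>. They converge to
    \<open>x\<close>.\<close>
  define w where "w = (\<lambda>r. splice x (r * p) z)"
  have w_in: "w r \<in> ?X" for r
    unfolding w_def using per[of 0 r] z(3)[of 0] by (intro splice_in x z) (simp add: r0_def)
  have w_shift: "(shift_map ^^ p) (w (Suc r)) = w r" for r
  proof
    fix t
    have "x (t + p) = x t" using per[of t 1] by simp
    then show "(shift_map ^^ p) (w (Suc r)) t = w r t"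
      by (auto simp: w_def splice_def funpow_shift_map)
  qed
  have w_agree: "w r t = x t" if "t < r * p + r0" for r t
    using that z(3)[of "t - r * p"] per[of "t - r * p" r]
    by (auto simp: w_def splice_def not_less)
  have y_shift: "h (w (Suc r)) (t + i) = h (w r) (t + j)" for r t
  proof -
    have "(shift_map ^^ i) (h (w (Suc r))) = (shift_map ^^ j) (h (w r))"
      using R[OF w_in, of "Suc r"] w_agree[of _ "Suc r"] by (simp add: w_shift r0_def)
    from fun_cong[OF this, of t] show ?thesis by (simp add: funpow_shift_map)
  qed
  have "(shift_map ^^ i) (h x) = (shift_map ^^ j) (h x)" using R[OF x] by (simp add: p(2))
  then have x_shift: "h x (t + i) = h x (t + j)" for t
    by (auto dest: fun_cong[of _ _ t] simp: funpow_shift_map)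
  \<comment> \<open>Agreement passes from \<open>w (Suc r)\<close> to \<open>w r\<close> without
    loss: letters before \<open>j\<close> agree by the choice of \<open>R1\<close>, and a letter at
    \<open>t \<ge> j\<close> is read at \<open>t - j + i\<close>, which is at most \<open>t\<close>
    because \<open>i \<le> j\<close>.\<close>
  have descend: "\<forall>t<J. h (w 0) t = h x t" if "\<forall>t<J. h (w r) t = h x t" for J r
    using that
  proof (induction r)
    case (Suc r)
    have "h (w r) t = h x t" if "t < J" for t
    proof (cases "t < j")
      case True
      then show ?thesis using R1[OF w_in, of r] w_agree[of _ r] by (simp add: r0_def)
    next
      case False
      then have "h (w r) t = h (w (Suc r)) (t - j + i)" using y_shift[of r "t - j"] by simp
      also have "\<dots> = h x (t - j + i)" using Suc.prems that \<open>i \<le> j\<close> False by simp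
      also have "\<dots> = h x t" using x_shift[of "t - j"] False by simp
      finally show ?thesis .
    qed
    then show ?case by (intro Suc.IH) simp
  qed
  \<comment> \<open>By continuity of \<open>h\<close>, some \<open>h (w r)\<close> agrees with
    \<open>h x\<close> beyond any given position; descending to \<open>w 0 = z\<close> contradicts
    injectivity.\<close>
  have "h (w 0) t = h x t" for t
  proof -
    obtain R2 where R2: "\<And>y. y \<in> ?X \<Longrightarrow> \<forall>s<R2. y s = x s \<Longrightarrow> \<forall>s<Suc t. h y s = h x s"
      using h_window[of "Suc t"] x by metis
    have "R2 \<le> R2 * p" using p(1) by simp
    then have "s < R2 * p + r0" if "s < R2" for s using that by linarith
    then have "\<forall>s<R2. w R2 s = x s" using w_agree by blast
    then have "\<forall>s<Suc t. h (w R2) s = h x s" by (rule R2[OF w_in])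
    then show ?thesis using descend by blast
  qed
  then have "h (w 0) = h x" by blast
  then have "w 0 = x" using h_inj w_in x by (meson inj_onD)
  then show False using z(2) by (simp add: w_def splice_def)
qed

text \<open>The cycle becomes an arrow from \<open>h x\<close> to itself with positive lag, so the
  value is a sum of \<open>f\<close> over a forward stretch of one orbit.\<close>

lemma pull_periodic_nonneg:
  assumes f: "\<And>y. y \<in> one_sided_shift B \<Longrightarrow> 0 \<le> f y"
    and x: "x \<in> one_sided_shift A" and p: "1 \<le> p" "(shift_map ^^ p) x = x"
  shows "0 \<le> birkhoff_sum (pull f) p x"
proof (rule tail_related_nonneg[OF f h_in[OF x]])
  show "tail_related f (h x) (h x) (birkhoff_sum lag p x) (birkhoff_sum (pull f) p x)"
    using tail_related_pull_funpow[OF x, of f p] p(2) by simp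
  show "0 \<le> birkhoff_sum lag p x" using lag_periodic_pos[OF x p] by simp
qed

end

locale orbit_equivalence =
  fwd: orbit_map A B h k1 l1 + bwd: orbit_map B A g k2 l2 for A B h g k1 l1 k2 l2 +
  assumes gh: "x \<in> one_sided_shift A \<Longrightarrow> g (h x) = x"
    and hg: "y \<in> one_sided_shift B \<Longrightarrow> h (g y) = y"
begin

text \<open>Interpreting this instance gives every later result with the two shifts
  exchanged.\<close>

lemma swap: "orbit_equivalence B A g h k2 l2 k1 l1"
  by unfold_locales (auto simp: gh hg)

text \<open>The difference of the two sides is locally constant, so it suffices to compare them at a
  nearby point \<open>z\<close> that is not eventually periodic.\<close>

lemma pull_pull:
  assumes f: "continuous_on (one_sided_shift A) f" and x: "x \<in> one_sided_shift A"
  shows "fwd.pull (bwd.pull f) x = f x"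
proof -
  let ?X = "one_sided_shift A" and ?F = "fwd.pull (bwd.pull f)"
  have "continuous_on ?X (\<lambda>x. ?F x - f x)"
    by (intro continuous_on_int_diff f fwd.continuous_on_pull bwd.continuous_on_pull)
  then obtain R where R: "local_on A R (\<lambda>x. ?F x - f x)" by (rule continuous_imp_local_on)
  obtain z where z: "z \<in> ?X" "\<And>i. i < R \<Longrightarrow> z i = x i"
      "\<And>i j. (shift_map ^^ i) z = (shift_map ^^ j) z \<Longrightarrow> i = j"
    using dense_not_eventually_periodic[OF fwd.condition_I x] by metis
  have sz: "shift_map z \<in> ?X" using z(1) by (rule shift_map_in)
  have "\<exists>m. tail_related f (g (h z)) (g (h (shift_map z))) m (?F z)"
    using fwd.tail_related_pull[OF z(1)] bwd.tail_related_pull_general fwd.h_in z(1) sz by blast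
  then obtain m where m: "tail_related f z (shift_map z) m (?F z)" using gh z(1) sz by auto
  have 1: "tail_related f z (shift_map z) 1 (f z)" using tail_related_funpow[of f z 1] by simp
  \<comment> \<open>Both the double pull and \<open>f z\<close> are values on arrows from
    \<open>z\<close> to \<open>shift_map z\<close>; equal lags make it the same arrow.\<close>
  have "m = 1" using tail_related_lag_unique[OF m 1 z(3)] .
  then have "?F z = f z" using m 1 tail_related_unique by blast
  then show ?thesis using local_onD[OF R z(1) x z(2)] by simp
qed

text \<open>A chain rule for lags: the lag of the inverse, summed along the path that
  \<open>h\<close> assigns to one shift, is that one shift.\<close>

lemma pull_lag:
  assumes "x \<in> one_sided_shift A"
  shows "fwd.pull bwd.lag x = 1"
proof -
  have "bwd.pull (\<lambda>x. 1) = bwd.lag" using bwd.pull_const by (intro ext)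
  then show ?thesis using pull_pull[OF continuous_on_const assms, of 1] by simp
qed

end

section \<open>The isomorphism of ordered groups\<close>

lemma birkhoff_sum_coboundary:
  assumes "\<And>y. y \<in> one_sided_shift A \<Longrightarrow> f y = \<xi> y - \<xi> (shift_map y)" "y \<in> one_sided_shift A"
  shows "birkhoff_sum f n y = \<xi> y - \<xi> ((shift_map ^^ n) y)"
  by (induction n) (auto simp: birkhoff_sum_Suc assms funpow_shift_map_in)

lemma birkhoff_sum_plus: "birkhoff_sum (\<lambda>x. f x + g x) n y = birkhoff_sum f n y + birkhoff_sum g n y"
  by (simp add: birkhoff_sum_def sum.distrib)

lemma cont_int_group_carrier:
  "\<xi> \<in> carrier (cont_int_group A) \<longleftrightarrow>
     \<xi> \<in> extensional (one_sided_shift A) \<and> continuous_on (one_sided_shift A) \<xi>"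
  by (simp add: cont_int_group_def)

lemma cont_int_group_mult:
  "\<xi> \<otimes>\<^bsub>cont_int_group A\<^esub> \<eta> = restrict (\<lambda>x. \<xi> x + \<eta> x) (one_sided_shift A)"
  by (simp add: cont_int_group_def)

lemma group_cont_int_group: "group (cont_int_group A)"
  using comm_group_cont_int_group by (rule comm_group.axioms)

lemma coboundariesI:
  assumes "continuous_on (one_sided_shift A) \<xi>" "f \<in> extensional (one_sided_shift A)"
    and "\<And>x. x \<in> one_sided_shift A \<Longrightarrow> f x = \<xi> x - \<xi> (shift_map x)"
  shows "f \<in> coboundaries A"
proof -
  let ?\<xi> = "restrict \<xi> (one_sided_shift A)"
  have "f = restrict (\<lambda>x. ?\<xi> x - ?\<xi> (shift_map x)) (one_sided_shift A)"
    by (rule extensionalityI[OF assms(2)]) (auto simp: assms(3) shift_map_in)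
  moreover have "?\<xi> \<in> carrier (cont_int_group A)"
    using assms(1) by (simp add: cont_int_group_carrier)
  ultimately show ?thesis unfolding coboundaries_def by blast
qed

lemma coboundariesE:
  assumes "f \<in> coboundaries A"
  obtains \<xi> where "continuous_on (one_sided_shift A) \<xi>"
    and "\<And>x. x \<in> one_sided_shift A \<Longrightarrow> f x = \<xi> x - \<xi> (shift_map x)"
proof -
  obtain \<xi> where "f = restrict (\<lambda>x. \<xi> x - \<xi> (shift_map x)) (one_sided_shift A)"
      "\<xi> \<in> carrier (cont_int_group A)"
    using assms unfolding coboundaries_def by blast
  then show thesis using that[of \<xi>] by (simp add: cont_int_group_carrier)
qed

lemma H_class_eq:
  assumes "f \<in> carrier (cont_int_group A)" "f' \<in> carrier (cont_int_group A)"
    and b: "continuous_on (one_sided_shift A) b"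
    and eq: "\<And>x. x \<in> one_sided_shift A \<Longrightarrow> f' x = f x + b x - b (shift_map x)"
  shows "H_class A f = H_class A f'"
proof -
  let ?X = "one_sided_shift A"
  have sub: "subgroup (coboundaries A) (cont_int_group A)"
    by (rule normal_imp_subgroup[OF normal_coboundaries])
  define d where "d = restrict (\<lambda>x. b x - b (shift_map x)) ?X"
  have "d \<in> coboundaries A"
    by (rule coboundariesI[OF b]) (auto simp: d_def)
  then have "d \<otimes>\<^bsub>cont_int_group A\<^esub> f \<in> coboundaries A #>\<^bsub>cont_int_group A\<^esub> f"
    using group.rcosI[OF group_cont_int_group] assms(1) subgroup.subset[OF sub] by blast
  moreover have "d \<otimes>\<^bsub>cont_int_group A\<^esub> f = f'"
    using assms(2) by (intro extensionalityI[of _ ?X])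
      (auto simp: cont_int_group_mult cont_int_group_carrier d_def eq)
  ultimately show ?thesis
    unfolding H_class_def
    using group.repr_independence[OF group_cont_int_group _ assms(1) sub] by simp
qed

section \<open>Pulling back cohomology classes\<close>

context orbit_map
begin

lemma pull_cong:
  assumes "\<And>y. y \<in> one_sided_shift B \<Longrightarrow> f y = f' y" "x \<in> one_sided_shift A"
  shows "pull f x = pull f' x"
  unfolding pull_def
  using birkhoff_sum_cong[of B f f'] assms h_in shift_map_in by metis

lemma pull_plus: "pull (\<lambda>x. f x + f' x) x = pull f x + pull f' x"
  by (simp add: pull_def birkhoff_sum_plus)

text \<open>Both sums telescope and end at the same point, whose contributions cancel; what remains
  is the coboundary of the composite of \<open>\<xi>\<close> with \<open>h\<close>.\<close>

lemma pull_coboundary: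
  assumes "\<And>y. y \<in> one_sided_shift B \<Longrightarrow> f y = \<xi> y - \<xi> (shift_map y)" "x \<in> one_sided_shift A"
  shows "pull f x = \<xi> (h x) - \<xi> (h (shift_map x))"
  unfolding pull_def
  using birkhoff_sum_coboundary[of B f \<xi>] assms h_in[OF assms(2)] h_in[OF shift_map_in[OF assms(2)]]
    h_shift[OF assms(2)] by simp

definition pull_group :: "((nat \<Rightarrow> nat) \<Rightarrow> int) \<Rightarrow> (nat \<Rightarrow> nat) \<Rightarrow> int" where
  "pull_group f = restrict (pull f) (one_sided_shift A)"

lemma pull_group_in:
  "f \<in> carrier (cont_int_group B) \<Longrightarrow> pull_group f \<in> carrier (cont_int_group A)"
  by (simp add: cont_int_group_carrier pull_group_def continuous_on_pull)

lemma pull_group_hom: "pull_group \<in> hom (cont_int_group B) (cont_int_group A)"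
proof (rule homI)
  fix f f' assume "f \<in> carrier (cont_int_group B)" "f' \<in> carrier (cont_int_group B)"
  have "pull (restrict (\<lambda>x. f x + f' x) (one_sided_shift B)) x = pull f x + pull f' x"
    if "x \<in> one_sided_shift A" for x
    using pull_cong[of "restrict (\<lambda>x. f x + f' x) (one_sided_shift B)" "\<lambda>x. f x + f' x" x] that
    by (simp add: pull_plus)
  then show "pull_group (f \<otimes>\<^bsub>cont_int_group B\<^esub> f') = pull_group f \<otimes>\<^bsub>cont_int_group A\<^esub> pull_group f'"
    by (auto simp: cont_int_group_mult pull_group_def restrict_def)
qed (rule pull_group_in)

lemma pull_group_coboundaries:
  assumes "f \<in> coboundaries B"
  shows "pull_group f \<in> coboundaries A"
proof -
  obtain \<xi> where \<xi>: "continuous_on (one_sided_shift B) \<xi>"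
      "\<And>x. x \<in> one_sided_shift B \<Longrightarrow> f x = \<xi> x - \<xi> (shift_map x)"
    using coboundariesE[OF assms] by metis
  show ?thesis
  proof (rule coboundariesI[where \<xi> = "\<lambda>x. \<xi> (h x)"])
    show "continuous_on (one_sided_shift A) (\<lambda>x. \<xi> (h x))"
      by (rule continuous_on_compose2[OF \<xi>(1) h_cont]) (auto intro: h_in)
  qed (auto simp: pull_group_def pull_coboundary[where f = f and \<xi> = \<xi>, OF \<xi>(2)])
qed

lemma H_class_pull_group_positive:
  assumes f: "f \<in> carrier (cont_int_group B)" "\<And>y. y \<in> one_sided_shift B \<Longrightarrow> 0 \<le> f y"
  shows "H_class A (pull_group f) \<in> H_positive A"
proof -
  let ?X = "one_sided_shift A"
  have cont: "continuous_on ?X (pull f)"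
    using f(1) continuous_on_pull by (simp add: cont_int_group_carrier)
  obtain b where b: "continuous_on ?X b" "\<And>x. x \<in> ?X \<Longrightarrow> 0 \<le> pull f x + b x - b (shift_map x)"
    using cohomologous_nonneg[OF cont pull_periodic_nonneg[OF f(2)]] by blast
  define e where "e = restrict (\<lambda>x. pull f x + b x - b (shift_map x)) ?X"
  have "continuous_on ?X (\<lambda>x. b (shift_map x))"
    by (rule continuous_on_compose2[OF b(1) continuous_on_subset[OF continuous_shift_map]])
       (auto intro: shift_map_in)
  then have e: "e \<in> carrier (cont_int_group A)"
    using cont b(1) by (auto simp: e_def cont_int_group_carrier intro!: continuous_on_int_diff continuous_on_add)
  have "H_class A (pull_group f) = H_class A e"
    by (rule H_class_eq[OF pull_group_in[OF f(1)] e b(1)]) (simp add: e_def pull_group_def)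
  moreover have "\<forall>x\<in>?X. 0 \<le> e x" using b(2) by (simp add: e_def)
  ultimately show ?thesis using e unfolding H_positive_def by blast
qed

end

context orbit_equivalence
begin

lemma pull_group_inverse:
  assumes "f \<in> carrier (cont_int_group A)"
  shows "fwd.pull_group (bwd.pull_group f) = f"
proof (rule extensionalityI)
  show "f \<in> extensional (one_sided_shift A)" using assms by (simp add: cont_int_group_carrier)
  fix x assume x: "x \<in> one_sided_shift A"
  have "fwd.pull (bwd.pull_group f) x = fwd.pull (bwd.pull f) x"
    by (rule fwd.pull_cong[OF _ x]) (simp add: bwd.pull_group_def)
  then show "fwd.pull_group (bwd.pull_group f) x = f x"
    using pull_pull[OF _ x] assms x by (simp add: fwd.pull_group_def cont_int_group_carrier)
qed (simp add: fwd.pull_group_def)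

text \<open>The first isomorphism theorem: since pulling back preserves coboundaries in both
  directions and the two pulls are inverse on functions, the kernel consists exactly of the
  coboundaries.\<close>

theorem ordered_group_iso:
  "\<exists>\<Phi>. \<Phi> \<in> iso (H_group A) (H_group B) \<and> \<Phi> ` H_positive A = H_positive B"
proof -
  let ?GA = "cont_int_group A" and ?GB = "cont_int_group B"
  interpret swapped: orbit_equivalence B A g h k2 l2 k1 l1 by (rule swap)
  interpret NB: normal "coboundaries B" ?GB by (rule normal_coboundaries)
  \<comment> \<open>Pulling back is contravariant, so the map out of the group of \<open>A\<close>
    comes from \<open>g\<close>.\<close>
  define F where "F = (\<lambda>f. H_class B (bwd.pull_group f))"
  have HB: "group (H_group B)" unfolding H_group_def by (rule NB.factorgroup_is_group)
  have "H_class B \<in> hom ?GB (H_group B)"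
    unfolding H_class_def H_group_def by (rule NB.r_coset_hom_Mod)
  from hom_compose[OF bwd.pull_group_hom this] have "F \<in> hom ?GA (H_group B)"
    by (simp add: F_def comp_def)
  then interpret F: group_hom ?GA "H_group B" F
    by (intro group_hom.intro group_hom_axioms.intro group_cont_int_group HB)
  have "f \<in> coboundaries A" if f: "f \<in> carrier ?GA" "F f = \<one>\<^bsub>H_group B\<^esub>" for f
  proof -
    have "coboundaries B #>\<^bsub>?GB\<^esub> bwd.pull_group f = coboundaries B"
      using f(2) by (simp add: F_def H_class_def H_group_def)
    then have "bwd.pull_group f \<in> coboundaries B"
      using NB.coset_join1[OF _ bwd.pull_group_in[OF f(1)] NB.is_subgroup] by blast
    then have "fwd.pull_group (bwd.pull_group f) \<in> coboundaries A"
      by (rule fwd.pull_group_coboundaries)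
    then show ?thesis using pull_group_inverse[OF f(1)] by simp
  qed
  moreover have "f \<in> carrier ?GA \<and> F f = \<one>\<^bsub>H_group B\<^esub>" if f: "f \<in> coboundaries A" for f
  proof -
    have fc: "f \<in> carrier ?GA"
      using f normal_imp_subgroup[OF normal_coboundaries] subgroup.subset by blast
    have "bwd.pull_group f \<in> coboundaries B" using f by (rule bwd.pull_group_coboundaries)
    then have "coboundaries B #>\<^bsub>?GB\<^esub> bwd.pull_group f = coboundaries B"
      using NB.coset_join2[OF bwd.pull_group_in[OF fc] NB.is_subgroup] by blast
    then show ?thesis using fc by (simp add: F_def H_class_def H_group_def)
  qed
  ultimately have ker: "kernel ?GA (H_group B) F = coboundaries A"
    unfolding kernel_def by blast
  have F_pull: "F (fwd.pull_group e) = H_class B e" if "e \<in> carrier ?GB" for e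
    unfolding F_def using swapped.pull_group_inverse[OF that] by simp
  have surj: "F ` carrier ?GA = carrier (H_group B)"
  proof (rule subset_antisym)
    show "carrier (H_group B) \<subseteq> F ` carrier ?GA"
    proof
      fix C assume "C \<in> carrier (H_group B)"
      then obtain e where e: "e \<in> carrier ?GB" "C = H_class B e"
        by (auto simp: H_group_def FactGroup_def RCOSETS_def H_class_def)
      then show "C \<in> F ` carrier ?GA"
        using F_pull[OF e(1)] fwd.pull_group_in[OF e(1)] by (metis imageI)
    qed
  qed (use F.hom_closed in blast)
  define \<Phi> where "\<Phi> = (\<lambda>C. the_elem (F ` C))"
  have iso: "\<Phi> \<in> iso (H_group A) (H_group B)"
    using F.FactGroup_iso_set[OF surj] unfolding ker \<Phi>_def H_group_def[of A] .
  \<comment> \<open>\<open>the_elem\<close> is meaningful here because \<open>F\<close> is constant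
    on each coset of its kernel.\<close>
  have \<Phi>: "\<Phi> (H_class A f) = F f" if f: "f \<in> carrier ?GA" for f
  proof -
    have "F c = F f" if c: "c \<in> coboundaries A #>\<^bsub>?GA\<^esub> f" for c
    proof -
      obtain d where d: "d \<in> coboundaries A" "c = d \<otimes>\<^bsub>?GA\<^esub> f"
        using c by (auto simp: r_coset_def)
      then have "d \<in> carrier ?GA" "F d = \<one>\<^bsub>H_group B\<^esub>"
        using ker unfolding kernel_def by blast+
      then show ?thesis using d f by simp
    qed
    moreover have "f \<in> coboundaries A #>\<^bsub>?GA\<^esub> f"
      using group.rcos_self[OF group_cont_int_group f normal_imp_subgroup[OF normal_coboundaries]] .
    ultimately have "F ` (coboundaries A #>\<^bsub>?GA\<^esub> f) = {F f}" by blast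
    then show ?thesis by (simp add: \<Phi>_def H_class_def)
  qed
  have "\<Phi> ` H_positive A = H_positive B"
  proof (intro subset_antisym subsetI)
    fix C assume "C \<in> \<Phi> ` H_positive A"
    then obtain f where f: "f \<in> carrier ?GA" "\<And>x. x \<in> one_sided_shift A \<Longrightarrow> 0 \<le> f x" "C = \<Phi> (H_class A f)"
      unfolding H_positive_def by blast
    then have "C = H_class B (bwd.pull_group f)" using \<Phi> by (simp add: F_def)
    then show "C \<in> H_positive B" using bwd.H_class_pull_group_positive[OF f(1,2)] by simp
  next
    fix C assume "C \<in> H_positive B"
    then obtain e where e: "e \<in> carrier ?GB" "\<And>x. x \<in> one_sided_shift B \<Longrightarrow> 0 \<le> e x" "C = H_class B e"
      unfolding H_positive_def by blast
    have "\<Phi> (H_class A (fwd.pull_group e)) = C"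
      using \<Phi>[OF fwd.pull_group_in[OF e(1)]] F_pull[OF e(1)] e(3) by simp
    then show "C \<in> \<Phi> ` H_positive A" using fwd.H_class_pull_group_positive[OF e(1,2)] by blast
  qed
  then show ?thesis using iso by blast
qed

end

section \<open>The induced map of two-sided shifts\<close>

definition shift_by :: "int \<Rightarrow> (int \<Rightarrow> nat) \<Rightarrow> (int \<Rightarrow> nat)" where
  "shift_by n x = (\<lambda>i. x (i + n))"

definition future :: "(int \<Rightarrow> nat) \<Rightarrow> (nat \<Rightarrow> nat)" where
  "future x = (\<lambda>i. x (int i))"

lemma shift_by_shift_by: "shift_by m (shift_by n x) = shift_by (m + n) x"
  by (auto simp: shift_by_def algebra_simps)

lemma shift_by_0 [simp]: "shift_by 0 x = x"
  by (simp add: shift_by_def)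

lemma shift_by_1: "shift_by 1 x = two_sided_shift_map x"
  by (simp add: shift_by_def two_sided_shift_map_def)

lemma shift_by_in: "x \<in> two_sided_shift A \<Longrightarrow> shift_by n x \<in> two_sided_shift A"
proof -
  assume x: "x \<in> two_sided_shift A"
  have "A $$ (x (i + n), x (i + 1 + n)) = 1" for i
  proof -
    have "A $$ (x (i + n), x (i + n + 1)) = 1" using x by (simp add: two_sided_shift_def)
    moreover have "i + 1 + n = i + n + 1" by simp
    ultimately show ?thesis by (simp only:)
  qed
  then show ?thesis using x by (simp add: two_sided_shift_def shift_by_def)
qed

lemma future_in: "x \<in> two_sided_shift A \<Longrightarrow> future x \<in> one_sided_shift A"
  by (auto simp: two_sided_shift_def one_sided_shift_def future_def add.commute)

lemma future_shift_by: "future (shift_by (int n) x) = (shift_map ^^ n) (future x)"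
  by (simp add: future_def shift_by_def funpow_shift_map)

lemma future_shift_by_le: "m \<le> n \<Longrightarrow> future (shift_by n x) = (shift_map ^^ nat (n - m)) (future (shift_by m x))"
  by (simp add: future_shift_by[symmetric] shift_by_shift_by)

lemma continuous_on_shift_by: "continuous_on S (shift_by n)"
  unfolding shift_by_def
  by (intro continuous_on_coordinatewise_then_product continuous_on_coordinate)

lemma continuous_on_future: "continuous_on S future"
  unfolding future_def
  by (intro continuous_on_coordinatewise_then_product continuous_on_coordinate)

text \<open>The negative branch is forced by additivity: the value at \<open>- m\<close> is minus
  the sum over the \<open>m\<close> steps that lead from the past back to time 0.\<close>

definition cocycle :: "((nat \<Rightarrow> nat) \<Rightarrow> int) \<Rightarrow> (int \<Rightarrow> nat) \<Rightarrow> int \<Rightarrow> int" where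
  "cocycle f x n =
     (if 0 \<le> n then birkhoff_sum f (nat n) (future x)
      else - birkhoff_sum f (nat (- n)) (future (shift_by n x)))"

lemma cocycle_0 [simp]: "cocycle f x 0 = 0"
  by (simp add: cocycle_def)

lemma cocycle_int: "cocycle f x (int n) = birkhoff_sum f n (future x)"
  by (simp add: cocycle_def)

lemma cocycle_step: "cocycle f x (n + 1) = cocycle f x n + f (future (shift_by n x))"
proof (cases "0 \<le> n")
  case True
  then obtain m where "n = int m" using nonneg_int_cases by blast
  then show ?thesis
    using cocycle_int[of f x "Suc m"] cocycle_int[of f x m]
    by (simp add: birkhoff_sum_Suc future_shift_by add.commute)
next
  case False
  define m where "m = nat (- n - 1)"
  have n: "n = - int (Suc m)" using False by (simp add: m_def)
  have "future (shift_by (n + 1) x) = shift_map (future (shift_by n x))"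
    using future_shift_by_le[of n "n + 1" x] by simp
  then have "birkhoff_sum f (Suc m) (future (shift_by n x)) =
      f (future (shift_by n x)) + birkhoff_sum f m (future (shift_by (n + 1) x))"
    by (simp add: birkhoff_sum_Suc2)
  moreover have "cocycle f x n = - birkhoff_sum f (Suc m) (future (shift_by n x))"
  proof -
    have "nat (- n) = Suc m" using n by simp
    then show ?thesis using False by (simp only: cocycle_def if_False)
  qed
  moreover have "cocycle f x (n + 1) = - birkhoff_sum f m (future (shift_by (n + 1) x))"
    using False n by (cases "m = 0") (auto simp: cocycle_def)
  ultimately show ?thesis by simp
qed

lemma cocycle_add: "cocycle f x (m + n) = cocycle f x m + cocycle f (shift_by m x) n"
proof (induction n rule: int_induct[of _ 0])
  case (step1 n)
  have "cocycle f x (m + (n + 1)) = cocycle f x (m + n + 1)" by (simp add: add.assoc)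
  then show ?case using step1 cocycle_step[of f x "m + n"] cocycle_step[of f "shift_by m x" n]
    by (simp only: shift_by_shift_by add.commute[of n m])
next
  case (step2 n)
  have "cocycle f x (m + n) = cocycle f x (m + (n - 1)) + f (future (shift_by (m + (n - 1)) x))"
    using cocycle_step[of f x "m + (n - 1)"] by (simp add: algebra_simps)
  moreover have "cocycle f (shift_by m x) n =
      cocycle f (shift_by m x) (n - 1) + f (future (shift_by (m + (n - 1)) x))"
    using cocycle_step[of f "shift_by m x" "n - 1"] by (simp add: shift_by_shift_by add.commute)
  ultimately show ?case using step2 by simp
qed simp

lemma cocycle_neg: "- cocycle f x (- int n) = birkhoff_sum f n (future (shift_by (- int n) x))"
  by (cases "n = 0") (simp_all add: cocycle_def)

lemma cocycle_diff:
  "m \<le> n \<Longrightarrow> birkhoff_sum f (nat (n - m)) (future (shift_by m x)) = cocycle f x n - cocycle f x m"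
  using cocycle_add[of f x m "n - m"] by (simp add: cocycle_def)

lemma cocycle_cong:
  assumes "\<And>u. u \<in> one_sided_shift A \<Longrightarrow> f u = g u" "x \<in> two_sided_shift A"
  shows "cocycle f x n = cocycle g x n"
  unfolding cocycle_def
  using birkhoff_sum_cong[of A f g] assms(1) future_in[OF assms(2)] future_in[OF shift_by_in[OF assms(2)]]
  by metis

lemma cocycle_const: "cocycle (\<lambda>u. 1) x n = n"
  by (simp add: cocycle_def birkhoff_sum_def)

lemma tail_related_shift_by: "tail_related f (future x) (future (shift_by n x)) n (cocycle f x n)"
proof (cases "0 \<le> n")
  case True
  then obtain m where "n = int m" using nonneg_int_cases by blast
  then show ?thesis using tail_related_funpow[of f "future x" m] by (simp add: future_shift_by cocycle_int)
next
  case False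
  then obtain m where n: "n = - int m" by (metis int_nat_eq linorder_linear minus_minus neg_0_le_iff_le nonneg_int_cases)
  have "tail_related f (future x) (future (shift_by n x)) (- int m) (- birkhoff_sum f m (future (shift_by n x)))"
    using tail_related_sym[OF tail_related_funpow[of f "future (shift_by n x)" m]]
    by (simp add: future_shift_by[symmetric] shift_by_shift_by n)
  then show ?thesis using False n by (simp add: cocycle_def)
qed

lemma continuous_on_cocycle:
  assumes "continuous_on (one_sided_shift A) f"
  shows "continuous_on (two_sided_shift A) (\<lambda>x. cocycle f x n)"
proof (cases "0 \<le> n")
  case True
  then show ?thesis unfolding cocycle_def
    by simp (rule continuous_on_compose2[OF continuous_on_birkhoff_sum[OF assms] continuous_on_future],
      auto intro: future_in)
next
  case False
  have "continuous_on (two_sided_shift A) (\<lambda>x. birkhoff_sum f (nat (- n)) (future (shift_by n x)))"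
    by (rule continuous_on_compose2[OF continuous_on_birkhoff_sum[OF assms]
          continuous_on_compose2[OF continuous_on_future continuous_on_shift_by subset_UNIV]])
       (auto intro: future_in shift_by_in)
  from continuous_on_int_uminus[OF this] show ?thesis using False by (simp add: cocycle_def)
qed

section \<open>Extending \<open>h\<close> along the past\<close>

context orbit_map
begin

lemma lag_growth:
  "\<exists>V M::nat. 1 \<le> V \<and> (\<forall>x\<in>one_sided_shift A. \<forall>n. int n - int M \<le> int V * birkhoff_sum lag n x)"
  using birkhoff_sum_linear_growth[OF continuous_on_lag lag_periodic_pos] .

lemma lag_eventually_ge:
  "\<exists>N. \<forall>x\<in>one_sided_shift A. \<forall>n\<ge>N. J \<le> birkhoff_sum lag n x"
proof -
  obtain V M :: nat where V: "1 \<le> V"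
      "\<And>x n. x \<in> one_sided_shift A \<Longrightarrow> int n - int M \<le> int V * birkhoff_sum lag n x"
    using lag_growth by blast
  have "J \<le> birkhoff_sum lag n x" if x: "x \<in> one_sided_shift A" and n: "nat (int V * \<bar>J\<bar> + int M) \<le> n" for x n
  proof -
    have "int V * J \<le> int V * \<bar>J\<bar>" by (intro mult_left_mono) auto
    also have "\<dots> \<le> int n - int M" using n by linarith
    also have "\<dots> \<le> int V * birkhoff_sum lag n x" by (rule V(2)[OF x])
    finally show ?thesis using V(1) by simp
  qed
  then show ?thesis by blast
qed

definition tail_bound :: "nat \<Rightarrow> bool" where
  "tail_bound K \<longleftrightarrow> (\<forall>x\<in>one_sided_shift A. \<forall>n. - int K \<le> birkhoff_sum lag n x \<and>
     (\<forall>i\<ge>K. h ((shift_map ^^ n) x) i = h x (nat (int i + birkhoff_sum lag n x))))"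

text \<open>One step compares the coordinates from \<open>k x\<close> on, where \<open>k\<close> is
  at most \<open>K0\<close>. Over many steps the index moves by partial sums of the lag, which never
  fall below \<open>- M\<close>; starting from \<open>K0 + M\<close> it thus stays in the admissible
  range for every \<open>n\<close>.\<close>

lemma tail_bound_exists: "\<exists>K. tail_bound K"
proof -
  let ?X = "one_sided_shift A"
  obtain V M :: nat where V: "1 \<le> V" "\<And>x n. x \<in> ?X \<Longrightarrow> int n - int M \<le> int V * birkhoff_sum lag n x"
    using lag_growth by blast
  have lower: "- int M \<le> birkhoff_sum lag n x" if "x \<in> ?X" for n x
  proof (rule ccontr)
    assume neg: "\<not> - int M \<le> birkhoff_sum lag n x"
    then have "int V * birkhoff_sum lag n x \<le> 1 * birkhoff_sum lag n x"
      using V(1) by (intro mult_right_mono_neg) auto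
    then show False using V(2)[OF that, of n] neg by linarith
  qed
  obtain K0 where K0: "\<And>x. x \<in> ?X \<Longrightarrow> k x \<le> K0"
    using compact_bounded_nat[OF compact_one_sided_shift k_cont] by blast
  have step: "h (shift_map x) i = h x (nat (int i + lag x))" if x: "x \<in> ?X" and i: "k x \<le> i" for x i
  proof -
    have "h (shift_map x) (i - k x + k x) = h x (i - k x + l x)"
      using fun_cong[OF h_shift[OF x], of "i - k x"] by (simp add: funpow_shift_map)
    moreover have "nat (int i + lag x) = i - k x + l x" using i by (simp add: lag_def)
    ultimately show ?thesis using i by simp
  qed
  have "h ((shift_map ^^ n) x) i = h x (nat (int i + birkhoff_sum lag n x))"
    if "x \<in> ?X" "K0 + M \<le> i" for n x i
    using that
  proof (induction n arbitrary: x)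
    case (Suc n)
    note sx = shift_map_in[OF Suc.prems(1)]
    let ?j = "nat (int i + birkhoff_sum lag n (shift_map x))"
    have "int K0 \<le> int i + birkhoff_sum lag n (shift_map x)" using lower[OF sx, of n] Suc.prems(2) by linarith
    then have j: "k x \<le> ?j" "int ?j = int i + birkhoff_sum lag n (shift_map x)"
      using K0[OF Suc.prems(1)] by linarith+
    have "h ((shift_map ^^ Suc n) x) i = h (shift_map x) ?j"
      using Suc.IH[OF sx Suc.prems(2)] by (simp add: funpow_swap1)
    also have "\<dots> = h x (nat (int i + birkhoff_sum lag (Suc n) x))"
      using step[OF Suc.prems(1) j(1)] j(2) by (simp add: birkhoff_sum_Suc2 add.commute add.left_commute)
    finally show ?case .
  qed simp
  moreover have "- int (K0 + M) \<le> birkhoff_sum lag n x" if "x \<in> ?X" for n x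
    using lower[OF that, of n] by simp
  ultimately have "tail_bound (K0 + M)" unfolding tail_bound_def by blast
  then show ?thesis by blast
qed

definition K :: nat where "K = (SOME K. tail_bound K)"

lemma K_tail:
  assumes "x \<in> one_sided_shift A" "K \<le> i"
  shows "h ((shift_map ^^ n) x) i = h x (nat (int i + birkhoff_sum lag n x))"
    and "0 \<le> int i + birkhoff_sum lag n x"
proof -
  have "tail_bound K" unfolding K_def by (rule someI_ex[OF tail_bound_exists])
  then have "- int K \<le> birkhoff_sum lag n x"
    "h ((shift_map ^^ n) x) i = h x (nat (int i + birkhoff_sum lag n x))"
    using assms unfolding tail_bound_def by blast+
  then show "h ((shift_map ^^ n) x) i = h x (nat (int i + birkhoff_sum lag n x))"
    "0 \<le> int i + birkhoff_sum lag n x" using assms(2) by auto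
qed

text \<open>How far into the past one must go so that coordinate \<open>j\<close> is read from
  \<open>h\<close> at an index of at least \<open>K\<close>. Independence of the point makes each
  coordinate of \<open>theta\<close> visibly continuous.\<close>

definition depth :: "int \<Rightarrow> nat" where
  "depth j = (SOME N. \<forall>x\<in>one_sided_shift A. \<forall>n\<ge>N. int K - j \<le> birkhoff_sum lag n x)"

lemma depth: "x \<in> one_sided_shift A \<Longrightarrow> int K - j \<le> birkhoff_sum lag (depth j) x"
  using someI_ex[OF lag_eventually_ge[of "int K - j"]] unfolding depth_def by blast

definition theta :: "(int \<Rightarrow> nat) \<Rightarrow> (int \<Rightarrow> nat)" where
  "theta x = (\<lambda>j. let u = future (shift_by (- int (depth j)) x)
                  in h u (nat (j + birkhoff_sum lag (depth j) u)))"

text \<open>The definition reads each coordinate at one chosen time \<open>a\<close>; any other time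
  \<open>n\<close> gives the same letter. Whichever of \<open>a\<close> and \<open>n\<close> is
  earlier, \<open>K_tail\<close> carries the letter from the later time back to it, both indices
  being at least \<open>K\<close>.\<close>

lemma theta_spec:
  assumes x: "x \<in> two_sided_shift A" and i: "K \<le> i"
  shows "h (future (shift_by n x)) i = theta x (int i + cocycle lag x n)"
proof -
  define j where "j = int i + cocycle lag x n"
  define a where "a = - int (depth j)"
  have in_X: "future (shift_by m x) \<in> one_sided_shift A" for m
    by (intro future_in shift_by_in x)
  have a: "birkhoff_sum lag (depth j) (future (shift_by a x)) = - cocycle lag x a"
    unfolding a_def by (rule cocycle_neg[symmetric])
  have \<theta>: "theta x j = h (future (shift_by a x)) (nat (j - cocycle lag x a))"
    using a by (simp add: theta_def a_def[symmetric])
  have ge: "int K \<le> j - cocycle lag x a" using depth[OF in_X, of j a] a by simp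
  show ?thesis
  proof (cases "a \<le> n")
    case True
    have "h (future (shift_by n x)) i = h (future (shift_by a x)) (nat (int i + (cocycle lag x n - cocycle lag x a)))"
      using K_tail(1)[OF in_X i, of "nat (n - a)" a] future_shift_by_le[OF True, of x] cocycle_diff[OF True, of lag x]
      by simp
    then show ?thesis using \<theta> by (simp add: j_def add_diff_eq)
  next
    case False
    then have "n \<le> a" by simp
    define i' where "i' = nat (j - cocycle lag x a)"
    have i': "K \<le> i'" "int i' = j - cocycle lag x a" using ge by (auto simp: i'_def)
    have "h (future (shift_by a x)) i' = h (future (shift_by n x)) (nat (int i' + (cocycle lag x a - cocycle lag x n)))"
      using K_tail(1)[OF in_X i'(1), of "nat (a - n)" n] future_shift_by_le[OF \<open>n \<le> a\<close>, of x]
        cocycle_diff[OF \<open>n \<le> a\<close>, of lag x] by simp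
    moreover have "int i' + (cocycle lag x a - cocycle lag x n) = int i" using i'(2) by (simp add: j_def)
    moreover have "theta x j = h (future (shift_by a x)) i'" using \<theta> by (simp add: i'_def)
    ultimately show ?thesis by (simp add: j_def)
  qed
qed

lemma cocycle_lag_unbounded_below:
  assumes x: "x \<in> two_sided_shift A"
  shows "\<exists>n. cocycle lag x n \<le> J"
proof -
  obtain N where "\<forall>u\<in>one_sided_shift A. \<forall>n\<ge>N. - J \<le> birkhoff_sum lag n u"
    using lag_eventually_ge by blast
  then have "- J \<le> birkhoff_sum lag N (future (shift_by (- int N) x))"
    using future_in[OF shift_by_in[OF x]] by blast
  then show ?thesis using cocycle_neg[of lag x N] by (intro exI[of _ "- int N"]) simp
qed

text \<open>Far enough in the past the cocycle is so low that any coordinate is reached from an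
  index above both thresholds. Equivariance of \<open>theta\<close> follows from this
  characterisation.\<close>

lemma theta_unique:
  assumes x: "x \<in> two_sided_shift A"
    and y: "\<And>n i. K' \<le> i \<Longrightarrow> h (future (shift_by n x)) i = y (int i + cocycle lag x n)"
  shows "y = theta x"
proof
  fix j
  obtain n where n: "cocycle lag x n \<le> j - int (max K K')"
    using cocycle_lag_unbounded_below[OF x] by blast
  define i where "i = nat (j - cocycle lag x n)"
  have i: "K \<le> i" "K' \<le> i" "int i + cocycle lag x n = j" using n by (auto simp: i_def)
  show "y j = theta x j" using y[OF i(2), of n] theta_spec[OF x i(1), of n] i(3) by simp
qed

lemma theta_shift:
  assumes x: "x \<in> two_sided_shift A"
  shows "theta (shift_by n x) = shift_by (cocycle lag x n) (theta x)"
proof (rule theta_unique[OF shift_by_in[OF x], symmetric])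
  fix m i assume "K \<le> i"
  then show "h (future (shift_by m (shift_by n x))) i =
      shift_by (cocycle lag x n) (theta x) (int i + cocycle lag (shift_by n x) m)"
    using theta_spec[OF x, of i "m + n"] cocycle_add[of lag x n m]
    by (simp add: shift_by_shift_by shift_by_def add.commute add.left_commute)
qed

lemma theta_in:
  assumes x: "x \<in> two_sided_shift A"
  shows "theta x \<in> two_sided_shift B"
proof -
  have "theta x j < dim_row B \<and> B $$ (theta x j, theta x (j + 1)) = 1" for j
  proof -
    obtain n where n: "cocycle lag x n \<le> j - int K"
      using cocycle_lag_unbounded_below[OF x] by blast
    define i where "i = nat (j - cocycle lag x n)"
    have i: "K \<le> i" "int i + cocycle lag x n = j" using n by (auto simp: i_def)
    have "theta x j = h (future (shift_by n x)) i" "theta x (j + 1) = h (future (shift_by n x)) (i + 1)"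
      using theta_spec[OF x i(1), of n] theta_spec[OF x, of "i + 1" n] i by (simp_all add: algebra_simps)
    moreover have "h (future (shift_by n x)) \<in> one_sided_shift B"
      by (intro h_in future_in shift_by_in x)
    ultimately show ?thesis by (simp add: one_sided_shift_def)
  qed
  then show ?thesis by (simp add: two_sided_shift_def)
qed

lemma continuous_on_theta: "continuous_on (two_sided_shift A) theta"
proof (rule continuous_on_coordinatewise_then_product)
  fix j
  define u where "u = (\<lambda>x. future (shift_by (- int (depth j)) x))"
  have u: "continuous_on (two_sided_shift A) u"
    unfolding u_def by (rule continuous_on_compose2[OF continuous_on_future continuous_on_shift_by subset_UNIV])
  have "continuous_on (one_sided_shift A) (\<lambda>v. h v (nat (j + birkhoff_sum lag (depth j) v)))"
    by (rule continuous_on_discrete_index[OF continuous_on_birkhoff_sum[OF continuous_on_lag],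
          where F = "\<lambda>n v. h v (nat (j + n))"])
       (rule continuous_on_compose2[OF continuous_on_coordinate h_cont subset_UNIV])
  moreover have "u ` two_sided_shift A \<subseteq> one_sided_shift A"
    by (auto simp: u_def intro: future_in shift_by_in)
  ultimately have "continuous_on (two_sided_shift A) (\<lambda>x. h (u x) (nat (j + birkhoff_sum lag (depth j) (u x))))"
    using u continuous_on_compose2 by blast
  then show "continuous_on (two_sided_shift A) (\<lambda>x. theta x j)"
    by (simp add: theta_def u_def Let_def)
qed

lemma tail_related_pull_shift_by:
  assumes x: "x \<in> two_sided_shift A"
  shows "tail_related f (h (future x)) (h (future (shift_by n x))) (cocycle lag x n) (cocycle (pull f) x n)"
proof (cases "0 \<le> n")
  case True
  then obtain m where "n = int m" using nonneg_int_cases by blast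
  then show ?thesis
    using tail_related_pull_funpow[OF future_in[OF x], of f m] by (simp add: future_shift_by cocycle_int)
next
  case False
  define m where "m = nat (- n)"
  have n: "n = - int m" "\<not> 0 \<le> n" using False by (auto simp: m_def)
  have "tail_related f (h (future (shift_by n x))) (h (future x))
      (birkhoff_sum lag m (future (shift_by n x))) (birkhoff_sum (pull f) m (future (shift_by n x)))"
    using tail_related_pull_funpow[OF future_in[OF shift_by_in[OF x]], of f n m]
    by (simp add: future_shift_by[symmetric] shift_by_shift_by n(1))
  from tail_related_sym[OF this] show ?thesis using n by (simp add: cocycle_def)
qed

end

section \<open>Composing the two induced maps\<close>

context orbit_equivalence
begin

text \<open>The value of the inverse lag cocycle on the arrow of lag 0 from
  \<open>future (fwd.theta x)\<close> to \<open>h (future x)\<close>, two points that agree from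
  coordinate \<open>fwd.K\<close> on.\<close>

definition defect :: "(int \<Rightarrow> nat) \<Rightarrow> int" where
  "defect x = birkhoff_sum bwd.lag fwd.K (future (fwd.theta x)) -
              birkhoff_sum bwd.lag fwd.K (h (future x))"

lemma funpow_theta:
  assumes "x \<in> two_sided_shift A"
  shows "(shift_map ^^ fwd.K) (future (fwd.theta x)) = (shift_map ^^ fwd.K) (h (future x))"
proof
  fix i
  show "(shift_map ^^ fwd.K) (future (fwd.theta x)) i = (shift_map ^^ fwd.K) (h (future x)) i"
    using fwd.theta_spec[OF assms, of "i + fwd.K" 0] by (simp add: funpow_shift_map future_def)
qed

text \<open>The same arrow is evaluated directly and through \<open>h (future x)\<close> and
  \<open>h (future (shift_by n x))\<close>. The middle part has value \<open>n\<close> by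
  \<open>pull_lag\<close>; the two ends contribute the defects.\<close>

lemma cocycle_return:
  assumes x: "x \<in> two_sided_shift A"
  shows "cocycle bwd.lag (fwd.theta x) (cocycle fwd.lag x n) = n + defect x - defect (shift_by n x)"
proof -
  let ?T = "tail_related bwd.lag"
  have d: "?T (future (fwd.theta z)) (h (future z)) 0 (defect z)" if "z \<in> two_sided_shift A" for z
    by (rule tail_relatedI[OF funpow_theta[OF that]]) (simp_all add: defect_def)
  have "cocycle (fwd.pull bwd.lag) x n = n"
    using cocycle_cong[OF pull_lag x, where n = n] cocycle_const by simp
  then have "?T (h (future x)) (h (future (shift_by n x))) (cocycle fwd.lag x n) n"
    using fwd.tail_related_pull_shift_by[OF x, of bwd.lag n] by simp
  from tail_related_trans[OF tail_related_trans[OF d[OF x] this] tail_related_sym[OF d[OF shift_by_in[OF x, of n]]]]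
  have "?T (future (fwd.theta x)) (future (shift_by (cocycle fwd.lag x n) (fwd.theta x)))
      (cocycle fwd.lag x n) (n + defect x - defect (shift_by n x))"
    by (simp add: fwd.theta_shift[OF x] add.commute)
  from tail_related_unique[OF tail_related_shift_by this] show ?thesis .
qed

text \<open>The identity holds for all coordinates beyond a threshold that is uniform in the point.
  Applying it to shifts of \<open>x\<close> and correcting by \<open>cocycle_return\<close> yields
  every coordinate.\<close>

lemma theta_theta:
  assumes x: "x \<in> two_sided_shift A"
  shows "shift_by (defect x) (bwd.theta (fwd.theta x)) = x"
proof -
  let ?s = "birkhoff_sum bwd.lag fwd.K"
  have "continuous_on (one_sided_shift B) ?s"
    by (rule continuous_on_birkhoff_sum[OF bwd.continuous_on_lag])
  then obtain b :: nat where b: "\<And>u. u \<in> one_sided_shift B \<Longrightarrow> \<bar>?s u\<bar> \<le> int b"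
    using compact_bounded_int[OF compact_one_sided_shift] by blast
  have tail: "z (int i) = bwd.theta (fwd.theta z) (int i + defect z)"
    if z: "z \<in> two_sided_shift A" and i: "bwd.K + b \<le> i" for z i
  proof -
    let ?u = "h (future z)" and ?y = "fwd.theta z"
    have u: "?u \<in> one_sided_shift B" by (intro fwd.h_in future_in z)
    \<comment> \<open>Chosen so that moving \<open>fwd.K\<close> steps along the orbit of
      \<open>?u\<close>, where it has merged with that of \<open>?y\<close>, turns index
      \<open>t\<close> into \<open>i\<close>. The bound \<open>b\<close> keeps \<open>t\<close>
      above \<open>bwd.K\<close>.\<close>
    define t where "t = nat (int i - ?s ?u)"
    have t: "bwd.K \<le> t" "int t = int i - ?s ?u" using b[OF u] i by (auto simp: t_def)
    have "bwd.theta ?y (int t + ?s (future ?y)) = g (future (shift_by (int fwd.K) ?y)) t"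
      using bwd.theta_spec[OF fwd.theta_in[OF z] t(1), of "int fwd.K"] by (simp add: cocycle_int)
    also have "\<dots> = g ((shift_map ^^ fwd.K) ?u) t"
      by (simp add: future_shift_by funpow_theta[OF z])
    also have "\<dots> = g ?u (nat (int t + ?s ?u))"
      by (rule bwd.K_tail(1)[OF u t(1)])
    also have "\<dots> = z (int i)"
      using gh[OF future_in[OF z]] t(2) by (simp add: future_def)
    finally have "bwd.theta ?y (int t + ?s (future ?y)) = z (int i)" .
    moreover have "int t + ?s (future ?y) = int i + defect z" using t(2) by (simp add: defect_def)
    ultimately show ?thesis by simp
  qed
  show ?thesis
  proof
    fix j
    define i where "i = bwd.K + b"
    \<comment> \<open>This shift puts coordinate \<open>j\<close> of \<open>x\<close> at the
      threshold position \<open>i\<close>.\<close>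
    define n where "n = j - int i"
    let ?w = "bwd.theta (fwd.theta x)" and ?e = "defect (shift_by n x)"
    have "x j = shift_by n x (int i)" by (simp add: shift_by_def n_def)
    also have "\<dots> = bwd.theta (fwd.theta (shift_by n x)) (int i + ?e)"
      by (rule tail[OF shift_by_in[OF x]]) (simp add: i_def)
    also have "\<dots> = shift_by (n + defect x - ?e) ?w (int i + ?e)"
      by (simp add: fwd.theta_shift[OF x] bwd.theta_shift[OF fwd.theta_in[OF x]] cocycle_return[OF x])
    also have "\<dots> = shift_by (defect x) ?w j" by (simp add: shift_by_def n_def)
    finally show "shift_by (defect x) ?w j = x j" by simp
  qed
qed

end

section \<open>Flow equivalence\<close>

abbreviation susp :: "nat mat \<Rightarrow> (int \<Rightarrow> nat) \<Rightarrow> real \<Rightarrow> ((int \<Rightarrow> nat) \<times> real) set" where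
  "susp A x t \<equiv> suspension_rel A `` {(x, t)}"

lemma suspension_rel_shift_by:
  assumes x: "x \<in> two_sided_shift A"
  shows "((x, t), (shift_by n x, t - of_int n)) \<in> suspension_rel A"
proof -
  have one: "((y, s), (shift_by 1 y, s - 1)) \<in> suspension_rel A" if "y \<in> two_sided_shift A" for y s
  proof -
    have "suspension_step A (y, s) (shift_by 1 y, s - 1)"
      using that by (auto simp: suspension_step_def shift_by_1 intro!: exI[of _ "s - 1"])
    then show ?thesis using that shift_by_in[OF that, of 1] by (auto simp: suspension_rel_def)
  qed
  have trans: "trans (suspension_rel A)" and sym: "sym (suspension_rel A)"
    using equiv_suspension_rel[of A] by (auto simp: equiv_def)
  show ?thesis
  proof (induction n rule: int_induct[of _ 0])
    case base
    show ?case using x by (simp add: suspension_rel_def)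
  next
    case (step1 n)
    have "((shift_by n x, t - of_int n), (shift_by (n + 1) x, t - of_int (n + 1))) \<in> suspension_rel A"
      using one[OF shift_by_in[OF x, of n], of "t - of_int n"]
      by (simp add: shift_by_shift_by add.commute diff_diff_eq)
    then show ?case by (rule transD[OF trans step1(2)])
  next
    case (step2 n)
    have "((shift_by (n - 1) x, t - of_int (n - 1)), (shift_by n x, t - of_int n)) \<in> suspension_rel A"
      using one[OF shift_by_in[OF x, of "n - 1"], of "t - of_int (n - 1)"]
      by (simp add: shift_by_shift_by)
    then show ?case by (rule transD[OF trans step2(2) symD[OF sym]])
  qed
qed

text \<open>Since the two-sided shift is invertible, the generated equivalence is the orbit relation
  of an action of the integers; a backward generating step lowers \<open>n\<close> by one.\<close>

lemma suspension_rel_iff: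
  assumes x: "x \<in> two_sided_shift A"
  shows "((x, t), (y, s)) \<in> suspension_rel A \<longleftrightarrow> (\<exists>n. y = shift_by n x \<and> s = t - of_int n)"
proof
  assume "((x, t), (y, s)) \<in> suspension_rel A"
  then have "equivclp (suspension_step A) (x, t) (y, s)" by (simp add: suspension_rel_def)
  then have "\<exists>n. (y, s) = (shift_by n x, t - of_int n)"
  proof (induction rule: equivclp_induct)
    case base
    show ?case by (rule exI[of _ 0]) simp
  next
    case (step q r)
    obtain n where n: "q = (shift_by n x, t - of_int n)" using step.IH by blast
    from step.hyps(2) show ?case
    proof
      assume "suspension_step A q r"
      then have "r = (shift_by (1 + n) x, t - of_int (1 + n))"
        unfolding suspension_step_def n by (auto simp: shift_by_1[symmetric] shift_by_shift_by)
      then show ?thesis by blast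
    next
      assume "suspension_step A r q"
      then obtain z u where z: "r = (z, u + 1)" "shift_by n x = shift_by 1 z" "t - of_int n = u"
        unfolding suspension_step_def n by (auto simp: shift_by_1)
      have "shift_by (- 1) (shift_by 1 z) = z" by (simp add: shift_by_shift_by)
      then have "z = shift_by (n - 1) x" by (simp add: z(2)[symmetric] shift_by_shift_by)
      then have "r = (shift_by (n - 1) x, t - of_int (n - 1))" using z(1,3) by simp
      then show ?thesis by blast
    qed
  qed
  then show "\<exists>n. y = shift_by n x \<and> s = t - of_int n" by simp
qed (use suspension_rel_shift_by[OF x] in blast)

lemma susp_eq_iff:
  assumes "x \<in> two_sided_shift A" "y \<in> two_sided_shift A"
  shows "susp A x t = susp A y s \<longleftrightarrow> (\<exists>n. y = shift_by n x \<and> s = t - of_int n)"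
  using eq_equiv_class_iff[OF equiv_suspension_rel, of "(x, t)" A "(y, s)"] assms
  by (simp add: suspension_rel_iff)

lemma susp_shift_by:
  "x \<in> two_sided_shift A \<Longrightarrow> susp A (shift_by n x) (t - of_int n) = susp A x t"
  using susp_eq_iff[of x A "shift_by n x" t "t - of_int n"] shift_by_in[of x A n] by blast

lemma suspE:
  assumes "c \<in> topspace (suspension_space A)"
  obtains x t where "x \<in> two_sided_shift A" "c = susp A x t"
  using assms unfolding topspace_suspension_space quotient_def by auto

lemma susp_in: "x \<in> two_sided_shift A \<Longrightarrow> susp A x t \<in> topspace (suspension_space A)"
  unfolding topspace_suspension_space by (rule quotientI) simp

section \<open>Piecewise linear reparametrisation\<close>

definition interpolate :: "(int \<Rightarrow> real) \<Rightarrow> real \<Rightarrow> real" where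
  "interpolate P t = P \<lfloor>t\<rfloor> + (t - of_int \<lfloor>t\<rfloor>) * (P (\<lfloor>t\<rfloor> + 1) - P \<lfloor>t\<rfloor>)"

lemma interpolate_int [simp]: "interpolate P (of_int k) = P k"
  by (simp add: interpolate_def)

lemma interpolate_shift: "interpolate (\<lambda>k. P (k + n)) t = interpolate P (t + of_int n)"
  by (simp add: interpolate_def algebra_simps)

lemma interpolate_diff: "interpolate (\<lambda>k. P k - c) t = interpolate P t - c"
  by (simp add: interpolate_def)

text \<open>The formula with the floor changes its form at integers. This one is valid on both sides
  of \<open>k\<close>, which makes continuity jointly in the nodes and in time apparent.\<close>

lemma interpolate_near:
  assumes "of_int k - 1 < t" "t < of_int k + 1"
  shows "interpolate P t =
     P k + max 0 (t - of_int k) * (P (k + 1) - P k) + min 0 (t - of_int k) * (P k - P (k - 1))"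
proof (cases "of_int k \<le> t")
  case True
  then have "\<lfloor>t\<rfloor> = k" using assms by (intro floor_unique) auto
  then show ?thesis using True by (simp add: interpolate_def)
next
  case False
  then have fl: "\<lfloor>t\<rfloor> = k - 1" using assms by (intro floor_unique) auto
  have "interpolate P t = P (k - 1) + (t - (of_int k - 1)) * (P k - P (k - 1))"
    unfolding interpolate_def fl by simp
  then show ?thesis using False by (simp add: algebra_simps)
qed

lemma continuous_on_interpolate:
  fixes P :: "'a::topological_space \<Rightarrow> int \<Rightarrow> real"
  assumes P: "\<And>k. continuous_on S (\<lambda>x. P x k)"
  shows "continuous_on (S \<times> UNIV) (\<lambda>p. interpolate (P (fst p)) (snd p))"
  unfolding continuous_on_def
proof
  fix p assume p: "p \<in> S \<times> (UNIV :: real set)"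
  define k where "k = \<lfloor>snd p\<rfloor>"
  define G where "G = (\<lambda>q. P (fst q) k + max 0 (snd q - of_int k) * (P (fst q) (k + 1) - P (fst q) k)
      + min 0 (snd q - of_int k) * (P (fst q) k - P (fst q) (k - 1)))"
  have "continuous_on (S \<times> UNIV) (\<lambda>q. P (fst q) j)" for j
    by (rule continuous_on_compose2[OF P continuous_on_fst[OF continuous_on_id]]) auto
  then have "continuous_on (S \<times> UNIV) G"
    unfolding G_def by (intro continuous_intros)
  then have "(G \<longlongrightarrow> G p) (at p within S \<times> UNIV)" using p unfolding continuous_on_def by blast
  moreover have eq: "G q = interpolate (P (fst q)) (snd q)" if "q \<in> UNIV \<times> {of_int k - 1<..<of_int k + 1}" for q
    using that interpolate_near[of k "snd q" "P (fst q)"] by (auto simp: G_def)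
  have pk: "p \<in> UNIV \<times> {of_int k - 1<..<of_int k + 1}"
    unfolding k_def by (cases p) (auto, linarith+)
  moreover have "eventually (\<lambda>q. G q = interpolate (P (fst q)) (snd q)) (at p within S \<times> UNIV)"
    unfolding eventually_at_topological
    by (rule exI[of _ "UNIV \<times> {of_int k - 1<..<of_int k + 1}"]) (use pk eq in \<open>auto intro!: open_Times\<close>)
  ultimately show "((\<lambda>q. interpolate (P (fst q)) (snd q)) \<longlongrightarrow> interpolate (P (fst p)) (snd p)) (at p within S \<times> UNIV)"
    using Lim_transform_eventually[of G] eq[OF pk] by metis
qed

lemma strict_mono_interpolate:
  assumes P: "\<And>k. P k < P (k + 1)"
  shows "strict_mono (interpolate P)"
proof (rule strict_monoI)
  have mono: "P m \<le> P n" if "m \<le> n" for m n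
    using that by (induction n rule: int_ge_induct) (auto intro: order_trans less_imp_le[OF P])
  have lower: "P \<lfloor>t\<rfloor> \<le> interpolate P t" for t
    using P[of "\<lfloor>t\<rfloor>"] by (simp add: interpolate_def)
  have upper: "interpolate P t < P (\<lfloor>t\<rfloor> + 1)" for t
  proof -
    have "(t - of_int \<lfloor>t\<rfloor>) * (P (\<lfloor>t\<rfloor> + 1) - P \<lfloor>t\<rfloor>) < 1 * (P (\<lfloor>t\<rfloor> + 1) - P \<lfloor>t\<rfloor>)"
      using P[of "\<lfloor>t\<rfloor>"] by (intro mult_strict_right_mono) linarith+
    then show ?thesis by (simp add: interpolate_def)
  qed
  fix s t :: real assume "s < t"
  show "interpolate P s < interpolate P t"
  proof (cases "\<lfloor>s\<rfloor> = \<lfloor>t\<rfloor>")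
    case True
    then show ?thesis
      using \<open>s < t\<close> P[of "\<lfloor>t\<rfloor>"] by (simp add: interpolate_def)
  next
    case False
    then have "\<lfloor>s\<rfloor> + 1 \<le> \<lfloor>t\<rfloor>" using floor_mono[of s t] \<open>s < t\<close> by linarith
    then show ?thesis using upper[of s] mono[of "\<lfloor>s\<rfloor> + 1" "\<lfloor>t\<rfloor>"] lower[of t] by linarith
  qed
qed

lemma continuous_interpolate: "continuous_on UNIV (interpolate P)"
proof -
  have "continuous_on ({0} \<times> UNIV) (\<lambda>p::real \<times> real. interpolate P (snd p))"
    using continuous_on_interpolate[of "{0}" "\<lambda>_. P"] by simp
  moreover have "continuous_on UNIV (\<lambda>t::real. (0::real, t))" by (intro continuous_intros)
  ultimately have "continuous_on UNIV (\<lambda>t. interpolate P (snd (0::real, t)))"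
    by (rule continuous_on_compose2) auto
  then show ?thesis by simp
qed

text \<open>The uniform gap \<open>\<delta>\<close> makes the nodes unbounded in both directions,
  which strict increase alone does not give; the intermediate value theorem does the rest.\<close>

lemma surj_interpolate:
  assumes "0 < \<delta>" and P: "\<And>k. P k + \<delta> \<le> P (k + 1)"
  shows "surj (interpolate P)"
proof -
  have up: "P 0 + of_nat n * \<delta> \<le> P (int n)" for n
  proof (induction n)
    case (Suc n)
    then show ?case using P[of "int n"] by (simp add: algebra_simps)
  qed simp
  have down: "P (- int n) \<le> P 0 - of_nat n * \<delta>" for n
  proof (induction n)
    case (Suc n)
    then show ?case using P[of "- int (Suc n)"] by (simp add: algebra_simps)
  qed simp
  have "\<exists>t. interpolate P t = s" for s
  proof -
    obtain n :: nat where "\<bar>s - P 0\<bar> \<le> of_nat n * \<delta>"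
      using reals_Archimedean3[OF \<open>0 < \<delta>\<close>] less_imp_le by metis
    then have "P (- int n) \<le> s" "s \<le> P (int n)" using up[of n] down[of n] by linarith+
    then have "interpolate P (of_int (- int n)) \<le> s" "s \<le> interpolate P (of_int (int n))"
      by (simp_all only: interpolate_int)
    then show ?thesis
      using IVT'[of "interpolate P" "of_int (- int n)" s "of_int (int n)"]
        continuous_on_subset[OF continuous_interpolate subset_UNIV] by auto
  qed
  then show ?thesis unfolding surj_def by metis
qed

section \<open>A strictly increasing clock\<close>

context orbit_map
begin

definition window :: nat where
  "window = (SOME n. 1 \<le> n \<and> (\<forall>u\<in>one_sided_shift A. 1 \<le> birkhoff_sum lag n u))"

lemma window: "1 \<le> window" "u \<in> one_sided_shift A \<Longrightarrow> 1 \<le> birkhoff_sum lag window u"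
proof -
  obtain N where "\<forall>u\<in>one_sided_shift A. \<forall>n\<ge>N. 1 \<le> birkhoff_sum lag n u"
    using lag_eventually_ge by blast
  then have "1 \<le> max 1 N \<and> (\<forall>u\<in>one_sided_shift A. 1 \<le> birkhoff_sum lag (max 1 N) u)" by simp
  then have "\<exists>n\<ge>1. \<forall>u\<in>one_sided_shift A. 1 \<le> birkhoff_sum lag n u" by blast
  then have "1 \<le> window \<and> (\<forall>u\<in>one_sided_shift A. 1 \<le> birkhoff_sum lag window u)"
    unfolding window_def by (rule someI_ex)
  then show "1 \<le> window" "u \<in> one_sided_shift A \<Longrightarrow> 1 \<le> birkhoff_sum lag window u" by blast+
qed

text \<open>
  The lag cocycle need not increase at every step, but its average over a window of length
  \<open>window\<close>, which is cohomologous to it over the reals, does.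
\<close>

definition clock :: "(int \<Rightarrow> nat) \<Rightarrow> int \<Rightarrow> real" where
  "clock x j = of_int (\<Sum>i<window. cocycle lag x (j + int i)) / of_nat window"

definition tau :: "(int \<Rightarrow> nat) \<Rightarrow> real \<Rightarrow> real" where
  "tau x = interpolate (clock x)"

lemma clock_step:
  assumes x: "x \<in> two_sided_shift A"
  shows "clock x j + 1 / of_nat window \<le> clock x (j + 1)"
proof -
  \<comment> \<open>Consecutive window sums differ by a telescoping sum, namely the lag over one
    full window, which is at least 1.\<close>
  have "(\<Sum>i<window. cocycle lag x (j + 1 + int i)) - (\<Sum>i<window. cocycle lag x (j + int i)) =
      (\<Sum>i<window. cocycle lag x (j + int (Suc i)) - cocycle lag x (j + int i))"
    by (simp add: sum_subtractf algebra_simps)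
  also have "\<dots> = cocycle lag x (j + int window) - cocycle lag x j"
    using sum_lessThan_telescope[of "\<lambda>i. cocycle lag x (j + int i)" window] by simp
  also have "\<dots> = birkhoff_sum lag window (future (shift_by j x))"
    by (simp add: cocycle_add cocycle_int)
  also have "1 \<le> \<dots>" by (intro window future_in shift_by_in x)
  finally have "(\<Sum>i<window. cocycle lag x (j + int i)) + 1 \<le> (\<Sum>i<window. cocycle lag x (j + 1 + int i))"
    (is "?S + 1 \<le> ?S'") by linarith
  then have "real_of_int ?S + 1 \<le> of_int ?S'" by linarith
  then have "(real_of_int ?S + 1) / of_nat window \<le> of_int ?S' / of_nat window"
    by (rule divide_right_mono) simp
  then show ?thesis unfolding clock_def add_divide_distrib .
qed

lemma clock_shift: "clock (shift_by n x) j = clock x (j + n) - of_int (cocycle lag x n)"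
proof -
  have "cocycle lag (shift_by n x) m = cocycle lag x (m + n) - cocycle lag x n" for m
    using cocycle_add[of lag x n m] by (simp add: add.commute)
  then have "(\<Sum>i<window. cocycle lag (shift_by n x) (j + int i)) =
      (\<Sum>i<window. cocycle lag x (j + n + int i)) - int window * cocycle lag x n"
    by (simp add: sum_subtractf add.commute add.left_commute)
  then show ?thesis using window(1) by (simp add: clock_def diff_divide_distrib)
qed

text \<open>The integer subtracted from the time is the one by which \<open>theta_shift\<close>
  moves the point, so the pair of maps respects the identifications of the suspension.\<close>

lemma tau_shift: "tau (shift_by n x) t = tau x (t + of_int n) - of_int (cocycle lag x n)"
proof -
  have "clock (shift_by n x) = (\<lambda>j. clock x (j + n) - of_int (cocycle lag x n))"
    using clock_shift by blast
  then show ?thesis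
    by (simp add: tau_def interpolate_diff interpolate_shift[of "clock x" n])
qed

lemma strict_mono_tau: "x \<in> two_sided_shift A \<Longrightarrow> strict_mono (tau x)"
  unfolding tau_def
proof (rule strict_mono_interpolate)
  fix j assume "x \<in> two_sided_shift A"
  from clock_step[OF this, of j] show "clock x j < clock x (j + 1)"
    using window(1) by (smt (verit) divide_pos_pos of_nat_0_less_iff One_nat_def Suc_le_lessD)
qed

lemma surj_tau: "x \<in> two_sided_shift A \<Longrightarrow> surj (tau x)"
  unfolding tau_def using window(1)
  by (intro surj_interpolate[of "1 / of_nat window"] clock_step) auto

lemma continuous_tau: "continuous_on UNIV (tau x)"
  unfolding tau_def by (rule continuous_interpolate)

lemma continuous_on_tau: "continuous_on (two_sided_shift A \<times> UNIV) (\<lambda>p. tau (fst p) (snd p))"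
  unfolding tau_def
proof (rule continuous_on_interpolate)
  fix j
  have "continuous_on (two_sided_shift A) (\<lambda>x. \<Sum>i<window. cocycle lag x (j + int i))"
    by (intro continuous_on_sum continuous_on_cocycle continuous_on_lag)
  then show "continuous_on (two_sided_shift A) (\<lambda>x. clock x j)"
    unfolding clock_def
    by (rule continuous_on_discrete_compose[where g = "\<lambda>j. of_int j / of_nat window"])
qed

text \<open>All multiples of a nonzero period would have cocycle 0, against the growth of the lag.
  This separates integers that act equally on a periodic point.\<close>

lemma cocycle_lag_period:
  assumes x: "x \<in> two_sided_shift A" and e: "shift_by e x = x" "cocycle lag x e = 0"
  shows "e = 0"
proof (rule ccontr)
  assume "e \<noteq> 0"
  have "\<exists>d. shift_by (int d) x = x \<and> cocycle lag x (int d) = 0 \<and> 1 \<le> d"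
  proof (cases "0 \<le> e")
    case True
    then show ?thesis using e \<open>e \<noteq> 0\<close> by (intro exI[of _ "nat e"]) simp
  next
    case False
    have "shift_by (- e) x = shift_by (- e) (shift_by e x)" using e(1) by simp
    then have "shift_by (- e) x = x" by (simp add: shift_by_shift_by)
    moreover have "cocycle lag x (- e) = 0"
      using cocycle_add[of lag x e "- e"] e by simp
    ultimately show ?thesis using False by (intro exI[of _ "nat (- e)"]) simp
  qed
  then obtain d where d: "shift_by (int d) x = x" "cocycle lag x (int d) = 0" "1 \<le> d" by blast
  have per: "cocycle lag x (int (r * d)) = 0" for r
  proof (induction r)
    case (Suc r)
    have "int (Suc r * d) = int d + int (r * d)" by simp
    then show ?case using Suc d by (simp only: cocycle_add)
  qed simp
  obtain N where "\<forall>u\<in>one_sided_shift A. \<forall>n\<ge>N. 1 \<le> birkhoff_sum lag n u"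
    using lag_eventually_ge by blast
  moreover have "N \<le> N * d" using d(3) by simp
  ultimately have "1 \<le> birkhoff_sum lag (N * d) (future x)" using future_in[OF x] by blast
  then show False using per[of N] cocycle_int[of lag x "N * d"] by simp
qed

end

section \<open>The homeomorphism of suspensions\<close>

context orbit_equivalence
begin

abbreviation flow_map :: "(int \<Rightarrow> nat) \<times> real \<Rightarrow> ((int \<Rightarrow> nat) \<times> real) set" where
  "flow_map p \<equiv> susp B (fwd.theta (fst p)) (fwd.tau (fst p) (snd p))"

lemma flow_map_shift:
  assumes x: "x \<in> two_sided_shift A"
  shows "flow_map (shift_by n x, t - of_int n) = flow_map (x, t)"
  using susp_shift_by[OF fwd.theta_in[OF x]]
  by (simp add: fwd.theta_shift[OF x] fwd.tau_shift)

lemma flow_map_inj: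
  assumes x: "x \<in> two_sided_shift A" and x': "x' \<in> two_sided_shift A"
    and eq: "flow_map (x, t) = flow_map (x', t')"
  shows "susp A x t = susp A x' t'"
proof -
  let ?C = "cocycle fwd.lag x" and ?D = "cocycle bwd.lag (fwd.theta x)"
  obtain k where k: "fwd.theta x' = shift_by k (fwd.theta x)" "fwd.tau x' t' = fwd.tau x t - of_int k"
    using eq susp_eq_iff[OF fwd.theta_in[OF x] fwd.theta_in[OF x']] by auto
  \<comment> \<open>Forced by applying the inverse map: the shift by \<open>k\<close> becomes one by
    \<open>?D k\<close>, and the defects correct the two ends.\<close>
  define n where "n = defect x' + ?D k - defect x"
  have "shift_by (defect x') (bwd.theta (fwd.theta x')) =
      shift_by n (shift_by (defect x) (bwd.theta (fwd.theta x)))"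
    using bwd.theta_shift[OF fwd.theta_in[OF x], of k]
    by (simp add: k(1) shift_by_shift_by n_def)
  then have n: "x' = shift_by n x" using theta_theta[OF x] theta_theta[OF x'] by simp
  have "?D (?C n) = n + defect x - defect x'"
    using cocycle_return[OF x, of n] by (simp only: n[symmetric])
  also have "\<dots> = ?D k" by (simp add: n_def)
  finally have D: "?D (?C n) = ?D k" .
  have S: "shift_by (?C n) (fwd.theta x) = shift_by k (fwd.theta x)"
    using fwd.theta_shift[OF x, of n] k(1) n by simp
  \<comment> \<open>Both integers shift \<open>fwd.theta x\<close> equally and have the same inverse
    cocycle, so their difference is a period of zero cocycle.\<close>
  have "?C n - k = 0"
  proof (rule bwd.cocycle_lag_period)
    show "fwd.theta x' \<in> two_sided_shift B" by (rule fwd.theta_in[OF x'])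
    show "shift_by (?C n - k) (fwd.theta x') = fwd.theta x'"
      using S by (simp add: k(1) shift_by_shift_by)
    show "cocycle bwd.lag (fwd.theta x') (?C n - k) = 0"
      using cocycle_add[of bwd.lag "fwd.theta x" k "?C n - k"] D by (simp add: k(1))
  qed
  then have "fwd.tau x (t' + of_int n) = fwd.tau x t"
    using k(2) by (simp add: n fwd.tau_shift)
  then have "t' + of_int n = t" using strict_mono_eq[OF fwd.strict_mono_tau[OF x]] by blast
  then have "t' = t - of_int n" by simp
  then show ?thesis unfolding n using susp_shift_by[OF x, of n t] by simp
qed

text \<open>\<open>theta_theta\<close> for the exchanged equivalence exhibits \<open>y\<close> as a
  shift of the image of \<open>bwd.theta y\<close>; surjectivity of the clock supplies the matching
  time.\<close>

lemma flow_map_surj: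
  assumes y: "y \<in> two_sided_shift B"
  shows "\<exists>x\<in>two_sided_shift A. \<exists>t. flow_map (x, t) = susp B y s"
proof -
  interpret swapped: orbit_equivalence B A g h k2 l2 k1 l1 by (rule swap)
  let ?x = "bwd.theta y"
  have x: "?x \<in> two_sided_shift A" by (rule bwd.theta_in[OF y])
  from surjD[OF fwd.surj_tau[OF x], of "s + of_int (swapped.defect y)"]
  obtain t where "s + of_int (swapped.defect y) = fwd.tau ?x t" ..
  then have t: "fwd.tau ?x t = s + of_int (swapped.defect y)" by (rule sym)
  have "susp B (shift_by (swapped.defect y) (fwd.theta ?x)) (fwd.tau ?x t - of_int (swapped.defect y)) =
      flow_map (?x, t)"
    using susp_shift_by[OF fwd.theta_in[OF x]] by simp
  then have "flow_map (?x, t) = susp B y s"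
    unfolding swapped.theta_theta[OF y] t by simp
  with x show ?thesis by blast
qed

text \<open>Each translate is compact. The family is locally finite, because the time coordinate is
  bounded on \<open>W\<close> and translation by \<open>n\<close> lowers it by
  \<open>n\<close>.\<close>

lemma closed_flow_map_image:
  assumes W: "W \<subseteq> two_sided_shift A \<times> {0..1}" "compact W"
  shows "closed (\<Union>n. (\<lambda>p. (shift_by n (fwd.theta (fst p)), fwd.tau (fst p) (snd p) - of_int n)) ` W)"
    (is "closed (\<Union>n. ?E n ` W)")
proof -
  have sub: "W \<subseteq> two_sided_shift A \<times> UNIV" using W(1) by auto
  have tau: "continuous_on W (\<lambda>p. fwd.tau (fst p) (snd p))"
    by (rule continuous_on_subset[OF fwd.continuous_on_tau sub])
  have theta: "continuous_on W (\<lambda>p. fwd.theta (fst p))"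
    by (rule continuous_on_compose2[OF fwd.continuous_on_theta continuous_on_fst[OF continuous_on_id]])
       (use sub in auto)
  have "continuous_on W (?E n)" for n
    by (intro continuous_on_Pair continuous_on_diff tau continuous_on_const
        continuous_on_compose2[OF continuous_on_shift_by theta subset_UNIV])
  then have E: "closed (?E n ` W)" for n
    by (intro compact_imp_closed compact_continuous_image W(2))
  have "bounded ((\<lambda>p. fwd.tau (fst p) (snd p)) ` W)"
    by (intro compact_imp_bounded compact_continuous_image tau W(2))
  then obtain b where b: "\<And>p. p \<in> W \<Longrightarrow> \<bar>fwd.tau (fst p) (snd p)\<bar> \<le> b"
    unfolding bounded_iff by auto
  let ?Z = "\<Union>n. ?E n ` W"
  have nbhd: "\<exists>T. open T \<and> q \<in> T \<and> T \<subseteq> - ?Z" if q: "q \<in> - ?Z" for q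
  proof -
    \<comment> \<open>If a translate contains a point whose time is within 1 of that of
      \<open>q\<close>, its index is at most \<open>r\<close> in absolute value.\<close>
    define r where "r = b + \<bar>snd q\<bar> + 1"
    define I where "I = {- \<lceil>r\<rceil>..\<lceil>r\<rceil>}"
    have "closed (\<Union>n\<in>I. ?E n ` W)" by (intro closed_UN ballI E) (simp add: I_def)
    then have "open (- (\<Union>n\<in>I. ?E n ` W))" by (rule open_Compl)
    moreover have "open (UNIV \<times> {snd q - 1<..<snd q + 1} :: ((int \<Rightarrow> nat) \<times> real) set)"
      by (intro open_Times) auto
    ultimately have "open (- (\<Union>n\<in>I. ?E n ` W) \<inter> UNIV \<times> {snd q - 1<..<snd q + 1})" by (rule open_Int)
    moreover have "q \<in> - (\<Union>n\<in>I. ?E n ` W) \<inter> UNIV \<times> {snd q - 1<..<snd q + 1}"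
      using q by (cases q) auto
    moreover have "- (\<Union>n\<in>I. ?E n ` W) \<inter> UNIV \<times> {snd q - 1<..<snd q + 1} \<subseteq> - ?Z"
    proof
      fix z assume z: "z \<in> - (\<Union>n\<in>I. ?E n ` W) \<inter> UNIV \<times> {snd q - 1<..<snd q + 1}"
      have "z \<notin> ?E n ` W" for n
      proof
        assume "z \<in> ?E n ` W"
        then obtain p where p: "p \<in> W" "z = ?E n p" by blast
        have "snd q - 1 < snd z" "snd z < snd q + 1" using z by auto
        moreover have "snd z = fwd.tau (fst p) (snd p) - of_int n" by (simp add: p(2))
        ultimately have "\<bar>real_of_int n\<bar> \<le> r" using b[OF p(1)] unfolding r_def by linarith
        then have "n \<in> I" unfolding I_def by (simp, linarith)
        then show False using z \<open>z \<in> ?E n ` W\<close> by blast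
      qed
      then show "z \<in> - ?Z" by blast
    qed
    ultimately show ?thesis by blast
  qed
  have "open (- ?Z)" by (rule iffD2[OF open_subopen]) (intro ballI nbhd)
  then show ?thesis by (simp add: closed_def)
qed

theorem flow_equivalent: "flow_equivalent A B"
proof -
  let ?SA = "suspension_space A" and ?SB = "suspension_space B"
  let ?XA = "two_sided_shift A \<times> (UNIV :: real set)" and ?XB = "two_sided_shift B \<times> (UNIV :: real set)"
  have "continuous_map (top_of_set ?XA) (top_of_set ?XB) (\<lambda>p. (fwd.theta (fst p), fwd.tau (fst p) (snd p)))"
    unfolding continuous_map_in_subtopology
  proof (intro conjI)
    have "continuous_on ?XA (\<lambda>p. fwd.theta (fst p))"
      by (rule continuous_on_compose2[OF fwd.continuous_on_theta continuous_on_fst[OF continuous_on_id]]) auto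
    then show "continuous_map (top_of_set ?XA) euclidean (\<lambda>p. (fwd.theta (fst p), fwd.tau (fst p) (snd p)))"
      using fwd.continuous_on_tau by (simp add: continuous_on_Pair)
  qed (auto intro: fwd.theta_in)
  from continuous_map_compose[OF this quotient_imp_continuous_map[OF quotient_map_suspension]]
  have cont: "continuous_map (top_of_set ?XA) ?SB flow_map" by (simp add: comp_def)
  have wd: "flow_map p = flow_map q"
    if pq: "p \<in> topspace (top_of_set ?XA)" "q \<in> topspace (top_of_set ?XA)"
      "suspension_rel A `` {p} = suspension_rel A `` {q}" for p q
  proof -
    have x: "fst p \<in> two_sided_shift A" "fst q \<in> two_sided_shift A"
      using pq(1,2) by (simp_all add: mem_Times_iff)
    have "susp A (fst p) (snd p) = susp A (fst q) (snd q)" using pq(3) by (simp only: prod.collapse)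
    then obtain n where n: "fst q = shift_by n (fst p)" "snd q = snd p - of_int n"
      unfolding susp_eq_iff[OF x] by (elim exE conjE)
    show ?thesis using flow_map_shift[OF x(1), of n "snd p"] by (simp add: n)
  qed
  obtain H where H: "continuous_map ?SA ?SB H"
      "\<And>p. p \<in> topspace (top_of_set ?XA) \<Longrightarrow> H (suspension_rel A `` {p}) = flow_map p"
  proof (rule quotient_map_lift_exists[OF quotient_map_suspension cont wd])
    fix H assume "continuous_map ?SA ?SB H"
      "\<And>p. p \<in> topspace (top_of_set ?XA) \<Longrightarrow> H (suspension_rel A `` {p}) = flow_map p"
    then show thesis by (rule that)
  qed
  have H_susp: "H (susp A x t) = flow_map (x, t)" if "x \<in> two_sided_shift A" for x t
    using H(2)[of "(x, t)"] that by simp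
  have inj: "inj_on H (topspace ?SA)"
  proof (rule inj_onI)
    fix c d assume "c \<in> topspace ?SA" "d \<in> topspace ?SA" "H c = H d"
    then show "c = d" using flow_map_inj H_susp by (metis suspE)
  qed
  have surj: "H ` topspace ?SA = topspace ?SB"
  proof (intro subset_antisym subsetI)
    fix d assume "d \<in> topspace ?SB"
    then obtain y s where "y \<in> two_sided_shift B" "d = susp B y s" by (rule suspE)
    then obtain x t where "x \<in> two_sided_shift A" "H (susp A x t) = d"
      using flow_map_surj H_susp by metis
    then show "d \<in> H ` topspace ?SA" using susp_in by blast
  qed (use H(1) in \<open>auto simp: continuous_map_def\<close>)
  have "closed_map ?SA ?SB H"
    unfolding closed_map_def
  proof (intro allI impI)
    fix U assume U: "closedin ?SA U"
    have closed_X: "closed (two_sided_shift D \<times> (UNIV :: real set))" for D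
      by (intro closed_Times compact_imp_closed compact_two_sided_shift closed_UNIV)
    \<comment> \<open>Times in \<open>[0, 1]\<close> already represent every class, so this compact
      part of the closed saturated preimage of \<open>U\<close> determines \<open>U\<close>.\<close>
    define W where "W = {p \<in> ?XA. suspension_rel A `` {p} \<in> U} \<inter> (two_sided_shift A \<times> {0..1})"
    have "closedin (top_of_set ?XA) {p \<in> ?XA. suspension_rel A `` {p} \<in> U}"
      using closedin_continuous_map_preimage[OF quotient_imp_continuous_map[OF quotient_map_suspension] U]
      by simp
    then have "closed {p \<in> ?XA. suspension_rel A `` {p} \<in> U}"
      using closed_X closedin_closed_trans by blast
    then have W: "compact W"
      unfolding W_def by (intro closed_Int_compact compact_Times compact_two_sided_shift compact_Icc)
    have U_sub: "U \<subseteq> topspace ?SA" using U by (rule closedin_subset)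
    have "{q \<in> ?XB. suspension_rel B `` {q} \<in> H ` U} =
        (\<Union>n. (\<lambda>p. (shift_by n (fwd.theta (fst p)), fwd.tau (fst p) (snd p) - of_int n)) ` W)" (is "?L = ?R")
    proof (intro subset_antisym subsetI)
      fix q assume "q \<in> ?L"
      then obtain y s c where q: "q = (y, s)" "y \<in> two_sided_shift B" "susp B y s = H c" "c \<in> U" by auto
      obtain x t where c: "x \<in> two_sided_shift A" "c = susp A x t" using q(4) U_sub suspE by blast
      \<comment> \<open>The representative is moved into the fundamental domain, with time the
        fractional part of \<open>t\<close>.\<close>
      define z where "z = shift_by \<lfloor>t\<rfloor> x"
      have z: "z \<in> two_sided_shift A" unfolding z_def by (rule shift_by_in[OF c(1)])
      have c': "c = susp A z (t - of_int \<lfloor>t\<rfloor>)" using susp_shift_by[OF c(1)] c(2) by (simp add: z_def)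
      have frac: "0 \<le> t - of_int \<lfloor>t\<rfloor>" "t - of_int \<lfloor>t\<rfloor> \<le> 1" by linarith+
      have "(z, t - of_int \<lfloor>t\<rfloor>) \<in> W" using z c' q(4) frac by (simp add: W_def)
      moreover have "susp B (fwd.theta z) (fwd.tau z (t - of_int \<lfloor>t\<rfloor>)) = susp B y s"
        unfolding q(3) c' H_susp[OF z] by simp
      then have "\<exists>n. y = shift_by n (fwd.theta z) \<and> s = fwd.tau z (t - of_int \<lfloor>t\<rfloor>) - of_int n"
        unfolding susp_eq_iff[OF fwd.theta_in[OF z] q(2)] .
      ultimately show "q \<in> ?R" unfolding q(1) by force
    next
      fix q assume "q \<in> ?R"
      then obtain n p where p: "p \<in> W" "q = (shift_by n (fwd.theta (fst p)), fwd.tau (fst p) (snd p) - of_int n)"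
        by blast
      have x: "fst p \<in> two_sided_shift A" "susp A (fst p) (snd p) \<in> U" using p(1) by (auto simp: W_def)
      have "suspension_rel B `` {q} = H (susp A (fst p) (snd p))"
        unfolding p(2) H_susp[OF x(1)] by (simp add: susp_shift_by[OF fwd.theta_in[OF x(1)]])
      moreover have "q \<in> ?XB" using p(2) x(1) by (simp add: shift_by_in fwd.theta_in)
      ultimately show "q \<in> ?L" using x(2) by blast
    qed
    moreover have "closed ?R" by (rule closed_flow_map_image[OF _ W]) (auto simp: W_def)
    ultimately have "closedin (top_of_set ?XB) {q \<in> ?XB. suspension_rel B `` {q} \<in> H ` U}"
      by (intro closed_subset) auto
    moreover have "H ` U \<subseteq> topspace ?SB" using U_sub surj by blast
    ultimately show "closedin ?SB (H ` U)"
      using quotient_map_suspension[of B] unfolding quotient_map_closedin by simp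
  qed
  from bijective_closed_imp_homeomorphic_map[OF H(1) this surj inj]
  have homeo: "homeomorphic_map ?SA ?SB H" .
  \<comment> \<open>Surjectivity of \<open>\<tau>\<close> is carried along so that a flow orbit is
    mapped onto the whole orbit of the image and not merely into it.\<close>
  have flow: "\<exists>\<tau>. \<tau> 0 = 0 \<and> continuous_on UNIV \<tau> \<and> strict_mono \<tau> \<and> surj \<tau> \<and>
      (\<forall>s. H (suspension_flow s c) = suspension_flow (\<tau> s) (H c))" if cA: "c \<in> topspace ?SA" for c
  proof -
    obtain x t where c: "x \<in> two_sided_shift A" "c = susp A x t" using cA by (rule suspE)
    define \<tau> where "\<tau> = (\<lambda>s. fwd.tau x (t + s) - fwd.tau x t)"
    have "continuous_on UNIV (\<lambda>s. fwd.tau x (t + s))"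
      by (rule continuous_on_compose2[OF fwd.continuous_tau _ subset_UNIV]) (intro continuous_intros)
    then have "continuous_on UNIV \<tau>" unfolding \<tau>_def by (intro continuous_intros)
    moreover have "strict_mono \<tau>"
      using fwd.strict_mono_tau[OF c(1)] by (auto simp: \<tau>_def strict_mono_def)
    moreover have "surj \<tau>"
    proof (rule surjI)
      fix r
      have "fwd.tau x (inv_into UNIV (fwd.tau x) (r + fwd.tau x t)) = r + fwd.tau x t"
        by (rule surj_f_inv_f[OF fwd.surj_tau[OF c(1)]])
      then show "\<tau> (inv_into UNIV (fwd.tau x) (r + fwd.tau x t) - t) = r" by (simp add: \<tau>_def)
    qed
    moreover have "H (suspension_flow s c) = suspension_flow (\<tau> s) (H c)" for s
      by (simp add: c(2) suspension_flow_class H_susp[OF c(1)] \<tau>_def)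
    ultimately show ?thesis by (intro exI[of _ \<tau>]) (simp add: \<tau>_def)
  qed
  have orbits: "H ` flow_orbit c = flow_orbit (H c)" if c: "c \<in> topspace ?SA" for c
  proof -
    obtain \<tau> where \<tau>: "surj \<tau>" "\<And>s. H (suspension_flow s c) = suspension_flow (\<tau> s) (H c)"
      using flow[OF c] by (elim exE conjE) blast
    have "H ` flow_orbit c = (\<lambda>s. suspension_flow s (H c)) ` range \<tau>"
      by (simp add: flow_orbit_def image_image \<tau>(2))
    then show ?thesis using \<tau>(1) by (simp add: flow_orbit_def)
  qed
  show ?thesis
    unfolding flow_equivalent_def
  proof (intro exI[of _ H] conjI ballI homeo orbits)
    fix c assume "c \<in> topspace ?SA"
    from flow[OF this] obtain \<tau> :: "real \<Rightarrow> real" where \<tau>: "\<tau> 0 = 0" "continuous_on UNIV \<tau>" "strict_mono \<tau>"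
        "\<forall>s. H (suspension_flow s c) = suspension_flow (\<tau> s) (H c)"
      by (elim exE conjE)
    then show "\<exists>\<tau>. \<tau> 0 = 0 \<and> continuous_on UNIV \<tau> \<and> strict_mono \<tau> \<and>
        (\<forall>s. H (suspension_flow s c) = suspension_flow (\<tau> s) (H c))"
      by (intro exI[of _ \<tau>] conjI)
  qed
qed

end

theorem theorem3p5:
  fixes A B :: "nat mat" and N M :: nat
  assumes "markov_matrix N A" and "markov_matrix M B"
    and "irreducible_matrix A" and "irreducible_matrix B"
    and "condition_I A" and "condition_I B"
    and "continuously_orbit_equivalent A B"
  shows "(\<exists>\<Phi>. \<Phi> \<in> iso (H_group A) (H_group B) \<and> \<Phi> ` H_positive A = H_positive B) \<and>
         flow_equivalent A B"
proof -
  let ?X = "one_sided_shift A" and ?Y = "one_sided_shift B"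
  obtain h g and k1 l1 k2 l2 :: "(nat \<Rightarrow> nat) \<Rightarrow> nat"
    where hom: "homeomorphism ?X ?Y h g"
      and 1: "continuous_on ?X k1" "continuous_on ?X l1"
        "\<And>x. x \<in> ?X \<Longrightarrow> (shift_map ^^ k1 x) (h (shift_map x)) = (shift_map ^^ l1 x) (h x)"
      and 2: "continuous_on ?Y k2" "continuous_on ?Y l2"
        "\<And>x. x \<in> ?Y \<Longrightarrow> (shift_map ^^ k2 x) (g (shift_map x)) = (shift_map ^^ l2 x) (g x)"
    using assms(7) unfolding continuously_orbit_equivalent_def by metis
  have hg: "h ` ?X = ?Y" "g ` ?Y = ?X" "\<And>x. x \<in> ?X \<Longrightarrow> g (h x) = x" "\<And>y. y \<in> ?Y \<Longrightarrow> h (g y) = y"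
    "continuous_on ?X h" "continuous_on ?Y g"
    using hom by (auto simp: homeomorphism_def)
  have "inj_on h ?X" "inj_on g ?Y" using hg(3,4) by (metis inj_onI)+
  then interpret orbit_equivalence A B h g k1 l1 k2 l2
    using assms(5,6) 1 2 hg by unfold_locales auto
  show ?thesis using ordered_group_iso flow_equivalent ..
qed

end
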